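(* Let $R=k[[x^d,x^{d-1}y,\ldots,xy^{d-1},y^d]]$, where $k$ is a field and $d$ is a positive integer. Let $S=k[[x,y]]$, so that $R$ is a (complete) Veronese subring of $S$. For any integer $0\leq i\leq d-1$, let $M_i$ be the maximal Cohen-Macaulay $R$-module generated by the degree $i$ monomials in $S$, i.e., $M_i=x^iR+x^{i-1}yR+\cdots+y^iR$. Then: (1) $R$ is $\mathrm{cl}_{M_i}$-rational for $0\leq i\leq d-2$; (2) $R$ is not $\mathrm{cl}_{M_{d-1}}$-rational.
   Context: Module closure: for an $R$-module $B$ and $R$-modules $L\subseteq M$, $L_M^{\mathrm{cl}_B}=\{u\in M\mid b\otimes u\in\operatorname{im}(B\otimes_R L\to B\otimes_R M)\text{ for all } b\in B\}$. $\mathrm{cl}$-rationality: let $(R,\mathfrak{m},k)$ be a Cohen-Macaulay complete local ring with canonical module $\omega$ and Krull dimension $n$, and let $E=E_R(k)$ be the injective hull of the residue field. Identify $\omega\cong\operatorname{Hom}_R(H^{n}_{\mathfrak{m}}(R),E)$. For a closure operation $\mathrm{cl}$ on $R$-modules, set $\tau_{\mathrm{cl}}(\omega)=\{f\in\operatorname{Hom}_R(H^{n}_{\mathfrak{m}}(R),E)\mid f(0^{\mathrm{cl}}_{H^{n}_{\mathfrak{m}}(R)})=0\}$. Then $R$ is $\mathrm{cl}$-rational if $\tau_{\mathrm{cl}}(\omega)=\omega$. (For the ring $R$ of the claim the Krull dimension is $n=2$.)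
   Formalization: Part (2) is stated only for d ≥ 2: for d = 1 one has R = S = M_0, the closure cl_R of 0 is 0, and R is cl_{M_0}-rational, so (2) fails as printed. *)

theory Defs
  imports
    "HOL-Computational_Algebra.Formal_Power_Series"
    "HOL-Algebra.AbelCoset"
    "HOL-Algebra.Free_Abelian_Groups"
    "HOL-Algebra.Module"
begin

section \<open>Modules: homomorphisms, quotients, localization\<close>

text \<open>
  Throughout, modules are records of type \<^typ>\<open>('r, 'm) module\<close>. The fields \<open>mult\<close> and \<open>one\<close> that
  this record inherits from rings play no role in the locale \<open>module\<close>; they are left \<open>undefined\<close>
  where there is no natural choice.
\<close>

definition linear_maps ::
  "('r, 'a) ring_scheme \<Rightarrow> ('r, 'm, 'b) module_scheme \<Rightarrow> ('r, 'n, 'c) module_scheme \<Rightarrow> ('m \<Rightarrow> 'n) set"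
  where "linear_maps R M N =
    {h \<in> carrier M \<rightarrow> carrier N.
       (\<forall>u\<in>carrier M. \<forall>v\<in>carrier M. h (u \<oplus>\<^bsub>M\<^esub> v) = h u \<oplus>\<^bsub>N\<^esub> h v) \<and>
       (\<forall>r\<in>carrier R. \<forall>u\<in>carrier M. h (r \<odot>\<^bsub>M\<^esub> u) = r \<odot>\<^bsub>N\<^esub> h u)}"

definition regular_module :: "('r, 'a) ring_scheme \<Rightarrow> ('r, 'r) module"
  where "regular_module R =
    \<lparr>carrier = carrier R, monoid.mult = mult R, one = \<one>\<^bsub>R\<^esub>, ring.zero = \<zero>\<^bsub>R\<^esub>, add = add R,
     smult = mult R\<rparr>"

definition quotient_module :: "('r, 'm, 'b) module_scheme \<Rightarrow> 'm set \<Rightarrow> ('r, 'm set) module"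
  where "quotient_module M L =
    \<lparr>carrier = a_rcosets\<^bsub>M\<^esub> L, monoid.mult = undefined, one = undefined, ring.zero = L, add = set_add M,
     smult = (\<lambda>r X. \<Union>u\<in>X. L +>\<^bsub>M\<^esub> (r \<odot>\<^bsub>M\<^esub> u))\<rparr>"

text \<open>\<open>frac R g a s\<close> is the fraction \<open>a / g\<^sup>s\<close> in the localization of \<open>R\<close> at the powers of \<open>g\<close>.\<close>

definition frac :: "('r, 'a) ring_scheme \<Rightarrow> 'r \<Rightarrow> 'r \<Rightarrow> nat \<Rightarrow> ('r \<times> nat) set"
  where "frac R g a s =
    {(b, t). b \<in> carrier R \<and>
       (\<exists>k::nat. g [^]\<^bsub>R\<^esub> k \<otimes>\<^bsub>R\<^esub> (g [^]\<^bsub>R\<^esub> t \<otimes>\<^bsub>R\<^esub> a) = g [^]\<^bsub>R\<^esub> k \<otimes>\<^bsub>R\<^esub> (g [^]\<^bsub>R\<^esub> s \<otimes>\<^bsub>R\<^esub> b))}"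

definition localization :: "('r, 'a) ring_scheme \<Rightarrow> 'r \<Rightarrow> ('r, ('r \<times> nat) set) module"
  where "localization R g =
    \<lparr>carrier = {frac R g a s |a s. a \<in> carrier R},
     monoid.mult = (\<lambda>X Y. \<Union>(a, s)\<in>X. \<Union>(b, t)\<in>Y. frac R g (a \<otimes>\<^bsub>R\<^esub> b) (s + t)),
     one = frac R g \<one>\<^bsub>R\<^esub> 0,
     ring.zero = frac R g \<zero>\<^bsub>R\<^esub> 0,
     add = (\<lambda>X Y. \<Union>(a, s)\<in>X. \<Union>(b, t)\<in>Y.
        frac R g (g [^]\<^bsub>R\<^esub> t \<otimes>\<^bsub>R\<^esub> a \<oplus>\<^bsub>R\<^esub> g [^]\<^bsub>R\<^esub> s \<otimes>\<^bsub>R\<^esub> b) (s + t)),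
     smult = (\<lambda>r X. \<Union>(a, s)\<in>X. frac R g (r \<otimes>\<^bsub>R\<^esub> a) s)\<rparr>"


section \<open>Top local cohomology\<close>

text \<open>
  For a local ring \<open>R\<close> of dimension \<open>n\<close> with system of parameters \<open>f\<^sub>1, \<dots>, f\<^sub>n\<close>, local cohomology
  is the cohomology of the Cech complex
  \<open>0 \<rightarrow> R \<rightarrow> \<Oplus>\<^sub>i R\<^bsub>f\<^sub>i\<^esub> \<rightarrow> \<dots> \<rightarrow> \<Oplus>\<^sub>i R\<^bsub>f\<^sub>1 \<dots> f\<^sub>i\<^sub>-\<^sub>1 f\<^sub>i\<^sub>+\<^sub>1 \<dots> f\<^sub>n\<^esub> \<rightarrow> R\<^bsub>f\<^sub>1 \<dots> f\<^sub>n\<^esub> \<rightarrow> 0\<close>.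
  In degree \<open>n\<close> this is the cokernel of the last map. Since only the image of that map is needed, its
  signs are immaterial.
\<close>

definition param_prod :: "('r, 'a) ring_scheme \<Rightarrow> 'r list \<Rightarrow> 'r"
  where "param_prod R fs = (\<Otimes>\<^bsub>R\<^esub>i\<in>{..<length fs}. fs ! i)"

text \<open>
  The image of the component \<open>R\<^sub>g \<rightarrow> R\<^bsub>g f\<^sub>i\<^esub>\<close> with \<open>g\<close> the product of the \<open>f\<^sub>j\<close> for \<open>j \<noteq> i\<close>;
  the map sends \<open>a / g\<^sup>s\<close> to \<open>a f\<^sub>i\<^sup>s / (g f\<^sub>i)\<^sup>s\<close>.
\<close>

definition cech_component :: "('r, 'a) ring_scheme \<Rightarrow> 'r list \<Rightarrow> nat \<Rightarrow> ('r \<times> nat) set set"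
  where "cech_component R fs i =
    {frac R (param_prod R fs) (a \<otimes>\<^bsub>R\<^esub> (fs ! i) [^]\<^bsub>R\<^esub> s) s |a (s::nat). a \<in> carrier R}"

definition cech_boundaries :: "('r, 'a) ring_scheme \<Rightarrow> 'r list \<Rightarrow> ('r \<times> nat) set set"
  where "cech_boundaries R fs =
    {\<Oplus>\<^bsub>localization R (param_prod R fs)\<^esub>i\<in>{..<length fs}. v i |v.
       \<forall>i<length fs. v i \<in> cech_component R fs i}"

definition top_local_cohomology ::
  "('r, 'a) ring_scheme \<Rightarrow> 'r list \<Rightarrow> ('r, ('r \<times> nat) set set) module"
  where "top_local_cohomology R fs =
    quotient_module (localization R (param_prod R fs)) (cech_boundaries R fs)"


section \<open>Injective hulls\<close>

text \<open>
  The modules on which injectivity is tested have to live on some fixed type \<open>'t\<close>. By Baer's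
  criterion the choice does not matter as long as \<open>R\<close> itself embeds into \<open>'t\<close>.
\<close>

definition injective_module :: "'t itself \<Rightarrow> ('r, 'a) ring_scheme \<Rightarrow> ('r, 'e) module \<Rightarrow> bool"
  where "injective_module T R E \<longleftrightarrow> Module.module R E \<and>
    (\<forall>(M :: ('r, 't) module) N f.
       Module.module R M \<and> submodule N R M \<and> f \<in> linear_maps R (M\<lparr>carrier := N\<rparr>) E \<longrightarrow>
       (\<exists>g\<in>linear_maps R M E. \<forall>u\<in>N. g u = f u))"

definition essential_submodule ::
  "'e set \<Rightarrow> ('r, 'a) ring_scheme \<Rightarrow> ('r, 'e) module \<Rightarrow> bool"
  where "essential_submodule N R E \<longleftrightarrow> submodule N R E \<and>
    (\<forall>P. submodule P R E \<and> P \<noteq> {\<zero>\<^bsub>E\<^esub>} \<longrightarrow> P \<inter> N \<noteq> {\<zero>\<^bsub>E\<^esub>})"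

definition injective_hull ::
  "'t itself \<Rightarrow> ('r, 'a) ring_scheme \<Rightarrow> ('r, 'm) module \<Rightarrow> ('r, 'e) module \<Rightarrow> bool"
  where "injective_hull T R K E \<longleftrightarrow> injective_module T R E \<and>
    (\<exists>\<iota>\<in>linear_maps R K E. inj_on \<iota> (carrier K) \<and> essential_submodule (\<iota> ` carrier K) R E)"

text \<open>For a local ring, the maximal ideal consists of the nonunits.\<close>

definition residue_field :: "('r, 'a) ring_scheme \<Rightarrow> ('r, 'r set) module"
  where "residue_field R = quotient_module (regular_module R) (carrier R - Units R)"

text \<open>
  \<open>E\<^sub>R(k)\<close>, unique up to isomorphism. The test type contains a copy of \<open>R\<close>, and it is also the
  type of the elements of \<open>H\<^sup>n\<^sub>\<mm>(R)\<close>.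
\<close>

definition residue_injective_hull :: "('r, 'a) ring_scheme \<Rightarrow> ('r, 'e) module \<Rightarrow> bool"
  where "residue_injective_hull R E \<longleftrightarrow>
    injective_hull TYPE(('r \<times> nat) set set) R (residue_field R) E"


section \<open>Tensor products and module closures\<close>

text \<open>
  Only the additive group of \<open>B \<otimes>\<^sub>R M\<close> is needed: the free abelian group on \<open>B \<times> M\<close> modulo the
  bilinearity relations.
\<close>

definition tensor_free :: "('r, 'b) module \<Rightarrow> ('r, 'm) module \<Rightarrow> ('b \<times> 'm \<Rightarrow>\<^sub>0 int) monoid"
  where "tensor_free B M = free_Abelian_group (carrier B \<times> carrier M)"

definition tensor_relations ::
  "('r, 'a) ring_scheme \<Rightarrow> ('r, 'b) module \<Rightarrow> ('r, 'm) module \<Rightarrow> ('b \<times> 'm \<Rightarrow>\<^sub>0 int) set"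
  where "tensor_relations R B M = generate (tensor_free B M)
    ({frag_of (b \<oplus>\<^bsub>B\<^esub> b', u) - frag_of (b, u) - frag_of (b', u) |b b' u.
        b \<in> carrier B \<and> b' \<in> carrier B \<and> u \<in> carrier M} \<union>
     {frag_of (b, u \<oplus>\<^bsub>M\<^esub> u') - frag_of (b, u) - frag_of (b, u') |b u u'.
        b \<in> carrier B \<and> u \<in> carrier M \<and> u' \<in> carrier M} \<union>
     {frag_of (r \<odot>\<^bsub>B\<^esub> b, u) - frag_of (b, r \<odot>\<^bsub>M\<^esub> u) |r b u.
        r \<in> carrier R \<and> b \<in> carrier B \<and> u \<in> carrier M})"

definition tensor_product ::
  "('r, 'a) ring_scheme \<Rightarrow> ('r, 'b) module \<Rightarrow> ('r, 'm) module \<Rightarrow> ('b \<times> 'm \<Rightarrow>\<^sub>0 int) set monoid"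
  where "tensor_product R B M = tensor_free B M Mod tensor_relations R B M"

definition pure_tensor ::
  "('r, 'a) ring_scheme \<Rightarrow> ('r, 'b) module \<Rightarrow> ('r, 'm) module \<Rightarrow> 'b \<Rightarrow> 'm \<Rightarrow> ('b \<times> 'm \<Rightarrow>\<^sub>0 int) set"
  where "pure_tensor R B M b u = tensor_relations R B M #>\<^bsub>tensor_free B M\<^esub> frag_of (b, u)"

text \<open>
  The map \<open>B \<otimes>\<^sub>R L \<rightarrow> B \<otimes>\<^sub>R M\<close> induced by an inclusion \<open>L \<subseteq> M\<close>. A coset of relations for \<open>B, L\<close> is
  a set of formal sums on \<open>B \<times> L \<subseteq> B \<times> M\<close>; it is enlarged to the coset of relations for \<open>B, M\<close>.
\<close>

definition tensor_incl ::
  "('r, 'a) ring_scheme \<Rightarrow> ('r, 'b) module \<Rightarrow> ('r, 'm) module \<Rightarrow>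
    ('b \<times> 'm \<Rightarrow>\<^sub>0 int) set \<Rightarrow> ('b \<times> 'm \<Rightarrow>\<^sub>0 int) set"
  where "tensor_incl R B M X = tensor_relations R B M <#>\<^bsub>tensor_free B M\<^esub> X"

definition module_closure ::
  "('r, 'a) ring_scheme \<Rightarrow> ('r, 'b) module \<Rightarrow> ('r, 'm) module \<Rightarrow> 'm set \<Rightarrow> 'm set"
  where "module_closure R B M L =
    {u \<in> carrier M. \<forall>b\<in>carrier B.
       pure_tensor R B M b u \<in>
         tensor_incl R B M ` carrier (tensor_product R B (M\<lparr>carrier := L\<rparr>))}"


section \<open>Rationality with respect to a closure operation\<close>

text \<open>
  \<open>cl M L\<close> is the closure of \<open>L\<close> in \<open>M\<close>, \<open>fs\<close> a system of parameters of \<open>R\<close>, \<open>E\<close> the injective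
  hull of the residue field, and \<open>\<omega> = Hom\<^sub>R(H\<^sup>n\<^sub>\<mm>(R), E)\<close>.
\<close>

definition canonical_module ::
  "('r, 'a) ring_scheme \<Rightarrow> 'r list \<Rightarrow> ('r, 'e) module \<Rightarrow> (('r \<times> nat) set set \<Rightarrow> 'e) set"
  where "canonical_module R fs E = linear_maps R (top_local_cohomology R fs) E"

definition closure_trace ::
  "('r, 'a) ring_scheme \<Rightarrow> 'r list \<Rightarrow> ('r, 'e) module \<Rightarrow>
    (('r, ('r \<times> nat) set set) module \<Rightarrow> ('r \<times> nat) set set set \<Rightarrow> ('r \<times> nat) set set set) \<Rightarrow>
    (('r \<times> nat) set set \<Rightarrow> 'e) set"
  where "closure_trace R fs E cl =
    (let H = top_local_cohomology R fs in
     {f \<in> linear_maps R H E. \<forall>u\<in>cl H {\<zero>\<^bsub>H\<^esub>}. f u = \<zero>\<^bsub>E\<^esub>})"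

definition cl_rational ::
  "('r, 'a) ring_scheme \<Rightarrow> 'r list \<Rightarrow> ('r, 'e) module \<Rightarrow>
    (('r, ('r \<times> nat) set set) module \<Rightarrow> ('r \<times> nat) set set set \<Rightarrow> ('r \<times> nat) set set set) \<Rightarrow> bool"
  where "cl_rational R fs E cl \<longleftrightarrow> closure_trace R fs E cl = canonical_module R fs E"


section \<open>The Veronese ring and the modules \<open>M\<^sub>i\<close>\<close>

text \<open>\<open>k[[x, y]]\<close> is realized as \<open>k[[x]][[y]]\<close>.\<close>

definition ps_x :: "'k::field fps fps" where "ps_x = fps_const fps_X"

definition ps_y :: "'k::field fps fps" where "ps_y = fps_X"

definition coeff2 :: "'k::field fps fps \<Rightarrow> nat \<Rightarrow> nat \<Rightarrow> 'k"
  where "coeff2 f p q = fps_nth (fps_nth f q) p"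

text \<open>
  The exponent vectors \<open>a = (a\<^sub>0, \<dots>, a\<^sub>d)\<close> such that the product of the \<open>(x\<^sup>d\<^sup>-\<^sup>j y\<^sup>j)\<^sup>a\<^sup>j\<close>
  is \<open>x\<^sup>p y\<^sup>q\<close>. There are finitely many if \<open>d > 0\<close>.
\<close>

definition veronese_exps :: "nat \<Rightarrow> nat \<Rightarrow> nat \<Rightarrow> (nat \<Rightarrow> nat) set"
  where "veronese_exps d p q =
    {a. (\<forall>j>d. a j = 0) \<and> (\<Sum>j\<le>d. a j * (d - j)) = p \<and> (\<Sum>j\<le>d. a j * j) = q}"

text \<open>
  \<open>k[[x\<^sup>d, x\<^sup>d\<^sup>-\<^sup>1y, \<dots>, y\<^sup>d]]\<close>: the image of the substitution map \<open>k[[z\<^sub>0, \<dots>, z\<^sub>d]] \<rightarrow> k[[x, y]]\<close>,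
  \<open>z\<^sub>j \<mapsto> x\<^sup>d\<^sup>-\<^sup>j y\<^sup>j\<close>, where a series in \<open>k[[z\<^sub>0, \<dots>, z\<^sub>d]]\<close> is given by its coefficient family \<open>c\<close>.
\<close>

definition veronese_carrier :: "nat \<Rightarrow> 'k::field fps fps set"
  where "veronese_carrier d =
    {f. \<exists>c. \<forall>p q. coeff2 f p q = (\<Sum>a\<in>veronese_exps d p q. c a)}"

lemma veronese_exps_degree:
  assumes "a \<in> veronese_exps d p q"
  shows "p + q = d * (\<Sum>j\<le>d. a j)"
proof -
  have "p + q = (\<Sum>j\<le>d. a j * (d - j) + a j * j)"
    using assms by (simp add: veronese_exps_def sum.distrib)
  also have "\<dots> = (\<Sum>j\<le>d. d * a j)"
  proof (rule sum.cong[OF refl])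
    fix j assume "j \<in> {..d}"
    then have "(d - j) + j = d" by simp
    then show "a j * (d - j) + a j * j = d * a j"
      by (metis distrib_left mult.commute)
  qed
  finally show ?thesis by (simp add: sum_distrib_left)
qed

lemma finite_veronese_exps:
  assumes "d > 0"
  shows "finite (veronese_exps d p q)"
proof (rule finite_subset)
  show "veronese_exps d p q \<subseteq>
      {a. \<forall>j. (j \<in> {..d} \<longrightarrow> a j \<in> {..p + q}) \<and> (j \<notin> {..d} \<longrightarrow> a j = 0)}"
  proof
    fix a assume a: "a \<in> veronese_exps d p q"
    have "a j \<le> p + q" if "j \<le> d" for j
    proof -
      have "a j \<le> (\<Sum>j\<le>d. a j)" using that by (intro member_le_sum) auto
      also have "\<dots> \<le> p + q" using veronese_exps_degree[OF a] assms by simp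
      finally show ?thesis .
    qed
    then show "a \<in> {a. \<forall>j. (j \<in> {..d} \<longrightarrow> a j \<in> {..p + q}) \<and> (j \<notin> {..d} \<longrightarrow> a j = 0)}"
      using a by (auto simp: veronese_exps_def)
  qed
qed (intro finite_set_of_finite_funs finite_atMost)

lemma veronese_exps_nonempty:
  assumes "p + q = d * n"
  shows "veronese_exps d p q \<noteq> {}"
  using assms
proof (induction n arbitrary: p q)
  case 0
  then have "(\<lambda>_. 0) \<in> veronese_exps d p q" by (simp add: veronese_exps_def)
  then show ?case by blast
next
  case (Suc n)
  define j where "j = min q d"
  have j: "j \<le> d" "j \<le> q" "d - j \<le> p" using Suc.prems by (auto simp: j_def min_def)
  have "(p - (d - j)) + (q - j) = d * n" using Suc.prems j by (simp add: algebra_simps)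
  then obtain a where a: "a \<in> veronese_exps d (p - (d - j)) (q - j)" using Suc.IH by blast
  have upd: "(\<Sum>i\<le>d. (a(j := Suc (a j))) i * g i) = g j + (\<Sum>i\<le>d. a i * g i)" for g :: "nat \<Rightarrow> nat"
    using j(1) by (simp add: sum.remove[of "{..d}" j])
  have "a(j := Suc (a j)) \<in> veronese_exps d p q"
    using a j unfolding veronese_exps_def mem_Collect_eq upd by auto
  then show ?case by blast
qed

lemma veronese_carrier_iff:
  assumes "d > 0"
  shows "f \<in> veronese_carrier d \<longleftrightarrow> (\<forall>p q. coeff2 f p q \<noteq> 0 \<longrightarrow> d dvd p + q)"
proof
  assume "f \<in> veronese_carrier d"
  then obtain c where c: "\<And>p q. coeff2 f p q = (\<Sum>a\<in>veronese_exps d p q. c a)"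
    by (auto simp: veronese_carrier_def)
  show "\<forall>p q. coeff2 f p q \<noteq> 0 \<longrightarrow> d dvd p + q"
  proof (intro allI impI)
    fix p q assume "coeff2 f p q \<noteq> 0"
    then have "veronese_exps d p q \<noteq> {}" using c by force
    then show "d dvd p + q" using veronese_exps_degree by (metis dvd_triv_left ex_in_conv)
  qed
next
  assume f: "\<forall>p q. coeff2 f p q \<noteq> 0 \<longrightarrow> d dvd p + q"
  define e where "e p q = (SOME a. a \<in> veronese_exps d p q)" for p q
  define P where "P a = (\<Sum>j\<le>d. a j * (d - j))" for a
  define Q where "Q a = (\<Sum>j\<le>d. a j * j)" for a
  define c where "c a = (if a = e (P a) (Q a) then coeff2 f (P a) (Q a) else 0)" for a
  have "coeff2 f p q = (\<Sum>a\<in>veronese_exps d p q. c a)" for p q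
  proof -
    have "(\<Sum>a\<in>veronese_exps d p q. c a) =
        (\<Sum>a\<in>veronese_exps d p q. if e p q = a then coeff2 f p q else 0)"
      by (intro sum.cong refl) (auto simp: c_def P_def Q_def veronese_exps_def)
    also have "\<dots> = (if e p q \<in> veronese_exps d p q then coeff2 f p q else 0)"
      using finite_veronese_exps[OF assms] by (simp add: sum.delta)
    also have "\<dots> = coeff2 f p q"
    proof (cases "coeff2 f p q = 0")
      case False
      then obtain n where "p + q = d * n" using f unfolding dvd_def by blast
      then have "veronese_exps d p q \<noteq> {}" by (rule veronese_exps_nonempty)
      then have "e p q \<in> veronese_exps d p q" unfolding e_def by (rule some_in_eq[THEN iffD2])
      then show ?thesis by simp
    qed auto
    finally show ?thesis by simp
  qed
  then show "f \<in> veronese_carrier d" by (auto simp: veronese_carrier_def)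
qed

definition veronese :: "nat \<Rightarrow> 'k::field fps fps ring"
  where "veronese d =
    \<lparr>carrier = veronese_carrier d, monoid.mult = (*), one = 1, ring.zero = 0, add = (+)\<rparr>"

lemma coeff2_simps [simp]:
  "coeff2 0 p q = 0" "coeff2 1 p q = (if p = 0 \<and> q = 0 then 1 else 0)"
  "coeff2 (f + g) p q = coeff2 f p q + coeff2 g p q" "coeff2 (- f) p q = - coeff2 f p q"
  by (auto simp: coeff2_def)

lemma coeff2_mult:
  "coeff2 (f * g) p q = (\<Sum>j\<le>q. \<Sum>i\<le>p. coeff2 f i j * coeff2 g (p - i) (q - j))"
  by (simp add: coeff2_def fps_mult_nth fps_sum_nth atLeast0AtMost)

lemma cring_veronese:
  assumes "d > 0"
  shows "cring (veronese d :: 'k::field fps fps ring)"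
proof -
  have mult: "f * g \<in> veronese_carrier d"
    if f: "f \<in> veronese_carrier d" and g: "g \<in> veronese_carrier d" for f g :: "'k fps fps"
    unfolding veronese_carrier_iff[OF assms]
  proof (intro allI impI)
    fix p q assume "coeff2 (f * g) p q \<noteq> 0"
    then obtain i j where ij: "j \<le> q" "i \<le> p" "coeff2 f i j * coeff2 g (p - i) (q - j) \<noteq> 0"
      unfolding coeff2_mult by (meson atMost_iff sum.not_neutral_contains_not_neutral)
    then have "d dvd i + j" "d dvd (p - i) + (q - j)"
      using f g unfolding veronese_carrier_iff[OF assms] by (metis mult_zero_left mult_zero_right)+
    then have "d dvd (i + j) + ((p - i) + (q - j))" by (rule dvd_add)
    also have "(i + j) + ((p - i) + (q - j)) = p + q" using ij by simp
    finally show "d dvd p + q" .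
  qed
  have add: "f + g \<in> veronese_carrier d"
    if "f \<in> veronese_carrier d" "g \<in> veronese_carrier d" for f g :: "'k fps fps"
    using that unfolding veronese_carrier_iff[OF assms] by (metis add_0 coeff2_simps(3))
  have minus: "- f \<in> veronese_carrier d" if "f \<in> veronese_carrier d" for f :: "'k fps fps"
    using that unfolding veronese_carrier_iff[OF assms] by simp
  have zero_one: "(0 :: 'k fps fps) \<in> veronese_carrier d" "(1 :: 'k fps fps) \<in> veronese_carrier d"
    unfolding veronese_carrier_iff[OF assms] by (auto split: if_splits)
  show ?thesis
  proof (rule cringI)
    show "abelian_group (veronese d :: 'k fps fps ring)"
    proof (rule abelian_groupI)
      fix f :: "'k fps fps" assume "f \<in> carrier (veronese d)"
      then show "\<exists>g\<in>carrier (veronese d). g \<oplus>\<^bsub>veronese d\<^esub> f = \<zero>\<^bsub>veronese d\<^esub>"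
        using minus by (intro bexI[of _ "- f"]) (auto simp: veronese_def)
    qed (auto simp: veronese_def add zero_one algebra_simps)
    show "comm_monoid (veronese d :: 'k fps fps ring)"
      by (rule comm_monoidI) (auto simp: veronese_def mult zero_one algebra_simps)
  qed (auto simp: veronese_def algebra_simps)
qed

text \<open>
  The maximal ideal of \<open>veronese d\<close> consists of the series without constant term. In this ring
  every monomial of degree at least \<open>2d\<close> is a multiple of \<open>x\<^sup>d\<close> or \<open>y\<^sup>d\<close>, so \<open>x\<^sup>d, y\<^sup>d\<close> is a system
  of parameters and computes top local cohomology.

  For \<open>d = 1\<close>, \<open>monomial_module d (d - 1)\<close> is the ring itself. Closure with respect to \<open>R\<close> is
  trivial, so rationality fails for \<open>i = d - 1\<close> only if \<open>d \<ge> 2\<close>.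
\<close>

definition monomial_module :: "nat \<Rightarrow> nat \<Rightarrow> ('k::field fps fps, 'k fps fps) module"
  where "monomial_module d i =
    \<lparr>carrier = {\<Sum>j\<le>i. ps_x ^ (i - j) * ps_y ^ j * r j |r. \<forall>j\<le>i. r j \<in> veronese_carrier d},
     monoid.mult = undefined, one = undefined, ring.zero = 0, add = (+), smult = (*)\<rparr>"

end

theory Submission
  imports Defs
begin

text \<open>
  The top local cohomology \<open>H\<close> of \<open>R\<close> is spanned by the monomials \<open>x\<^sup>-\<^sup>a y\<^sup>-\<^sup>b\<close> with \<open>a, b \<ge> 1\<close> and
  \<open>d\<close> dividing \<open>a + b\<close>. For a monomial \<open>n\<close>, the coefficient of \<open>x\<^sup>0y\<^sup>0\<close> in \<open>x y n b u\<close> is a balanced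
  pairing of \<open>b \<in> M\<^sub>i\<close> and \<open>u \<in> H\<close>, hence it factors through \<open>M\<^sub>i \<otimes> H\<close>. If \<open>u \<noteq> 0\<close> contains
  \<open>x\<^sup>-\<^sup>a y\<^sup>-\<^sup>b\<close>, then \<open>a + b \<ge> d \<ge> i + 2\<close>, so some generator of \<open>M\<^sub>i\<close> divides \<open>x\<^bsup>a-1\<^esup> y\<^bsup>b-1\<^esup>\<close>, and a
  suitable \<open>n\<close> detects \<open>u\<close>. Thus the closure of \<open>0\<close> in \<open>H\<close> is trivial for \<open>i \<le> d - 2\<close>.

  For \<open>i = d - 1\<close> the nonzero class of \<open>x\<^sup>-\<^sup>1 y\<^bsup>-(d-1)\<^esup>\<close> lies in the closure of \<open>0\<close>. The maximal ideal
  kills it, so it spans a copy of \<open>k\<close>, and the embedding of \<open>k\<close> into \<open>E\<close> extends to a map \<open>H \<rightarrow> E\<close>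
  that does not vanish on it.
\<close>

section \<open>Modules\<close>

lemma quotient_module_simps [simp]:
  "carrier (quotient_module M L) = a_rcosets\<^bsub>M\<^esub> L"
  "\<zero>\<^bsub>quotient_module M L\<^esub> = L"
  "X \<oplus>\<^bsub>quotient_module M L\<^esub> Y = X <+>\<^bsub>M\<^esub> Y"
  by (simp_all add: quotient_module_def)

context module
begin

lemma submodule_imp_abelian_subgroup: "submodule L R M \<Longrightarrow> abelian_subgroup L M"
  by (intro abelian_subgroupI3)
    (auto simp: additive_subgroup_def submodule_def M.abelian_group_axioms)

lemma coset_in_quotient: "u \<in> carrier M \<Longrightarrow> L +>\<^bsub>M\<^esub> u \<in> carrier (quotient_module M L)"
  by (auto simp: A_RCOSETS_def')

lemma quotient_cosetE:
  assumes "X \<in> carrier (quotient_module M L)"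
  obtains u where "u \<in> carrier M" "X = L +>\<^bsub>M\<^esub> u"
  using assms by (auto simp: A_RCOSETS_def')

text \<open>The scalar action on the quotient is a union of cosets over all representatives. Since
  \<open>L\<close> is closed under scalars, each representative gives the same coset, and a union of
  equal sets over a nonempty index set is that set.\<close>

lemma quotient_smult_coset:
  assumes L: "submodule L R M" and r: "r \<in> carrier R" and u: "u \<in> carrier M"
  shows "r \<odot>\<^bsub>quotient_module M L\<^esub> (L +>\<^bsub>M\<^esub> u) = L +>\<^bsub>M\<^esub> (r \<odot>\<^bsub>M\<^esub> u)"
proof -
  interpret L: abelian_subgroup L M by (rule submodule_imp_abelian_subgroup[OF L])
  have eq: "L +>\<^bsub>M\<^esub> (r \<odot>\<^bsub>M\<^esub> v) = L +>\<^bsub>M\<^esub> (r \<odot>\<^bsub>M\<^esub> u)" if v: "v \<in> L +>\<^bsub>M\<^esub> u" for v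
  proof -
    obtain l where l: "l \<in> L" "v = l \<oplus>\<^bsub>M\<^esub> u" using v by (auto simp: a_r_coset_def')
    then have "r \<odot>\<^bsub>M\<^esub> v = r \<odot>\<^bsub>M\<^esub> l \<oplus>\<^bsub>M\<^esub> r \<odot>\<^bsub>M\<^esub> u"
      using r u L.a_subset by (auto simp: smult_r_distr)
    moreover have "r \<odot>\<^bsub>M\<^esub> l \<in> L" using L l(1) r by (simp add: submodule.smult_closed)
    ultimately have "r \<odot>\<^bsub>M\<^esub> v \<in> L +>\<^bsub>M\<^esub> (r \<odot>\<^bsub>M\<^esub> u)" by (auto simp: a_r_coset_def')
    then show ?thesis using r u L.a_subgroup M.a_repr_independence by auto
  qed
  have "r \<odot>\<^bsub>quotient_module M L\<^esub> (L +>\<^bsub>M\<^esub> u) =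
      (\<Union>v\<in>L +>\<^bsub>M\<^esub> u. L +>\<^bsub>M\<^esub> (r \<odot>\<^bsub>M\<^esub> v))"
    by (simp add: quotient_module_def)
  also have "\<dots> = (\<Union>v\<in>L +>\<^bsub>M\<^esub> u. L +>\<^bsub>M\<^esub> (r \<odot>\<^bsub>M\<^esub> u))"
    by (rule SUP_cong[OF refl eq])
  also have "\<dots> = L +>\<^bsub>M\<^esub> (r \<odot>\<^bsub>M\<^esub> u)"
    using L.a_rcos_self[OF u] by (subst UN_constant) auto
  finally show ?thesis .
qed

lemma module_quotient_module:
  assumes L: "submodule L R M"
  shows "module R (quotient_module M L)"
proof -
  interpret L: abelian_subgroup L M by (rule submodule_imp_abelian_subgroup[OF L])
  show ?thesis
  proof (rule moduleI)
    show "cring R" by (rule R.cring_axioms)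
    show "abelian_group (quotient_module M L)"
    proof (rule abelian_groupI)
      fix X assume "X \<in> carrier (quotient_module M L)"
      then obtain u where u: "u \<in> carrier M" "X = L +>\<^bsub>M\<^esub> u" by (rule quotient_cosetE)
      have "L +>\<^bsub>M\<^esub> (\<ominus>\<^bsub>M\<^esub> u) <+>\<^bsub>M\<^esub> (L +>\<^bsub>M\<^esub> u) = L"
        using u by (simp add: L.a_rcos_sum M.l_neg L.a_subset)
      then show "\<exists>Y\<in>carrier (quotient_module M L).
          Y \<oplus>\<^bsub>quotient_module M L\<^esub> X = \<zero>\<^bsub>quotient_module M L\<^esub>"
        using u coset_in_quotient[of "\<ominus>\<^bsub>M\<^esub> u" L] by auto
    next
      show "\<zero>\<^bsub>quotient_module M L\<^esub> \<in> carrier (quotient_module M L)"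
        using coset_in_quotient[OF M.zero_closed, of L] by (simp add: L.a_subset)
      show "\<zero>\<^bsub>quotient_module M L\<^esub> \<oplus>\<^bsub>quotient_module M L\<^esub> X = X"
        if X: "X \<in> carrier (quotient_module M L)" for X
      proof -
        obtain u where u: "u \<in> carrier M" "X = L +>\<^bsub>M\<^esub> u" using X by (rule quotient_cosetE)
        then show ?thesis
          using L.a_rcos_sum[OF M.zero_closed u(1)] by (simp add: L.a_subset)
      qed
    next
      fix X Y assume "X \<in> carrier (quotient_module M L)" "Y \<in> carrier (quotient_module M L)"
      then obtain u v where u: "u \<in> carrier M" "X = L +>\<^bsub>M\<^esub> u" and v: "v \<in> carrier M" "Y = L +>\<^bsub>M\<^esub> v"
        by (elim quotient_cosetE)
      then have XY: "X \<oplus>\<^bsub>quotient_module M L\<^esub> Y = L +>\<^bsub>M\<^esub> (u \<oplus>\<^bsub>M\<^esub> v)"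
        by (simp add: L.a_rcos_sum)
      show "X \<oplus>\<^bsub>quotient_module M L\<^esub> Y \<in> carrier (quotient_module M L)"
        unfolding XY using u v by (intro coset_in_quotient M.a_closed)
      show "X \<oplus>\<^bsub>quotient_module M L\<^esub> Y = Y \<oplus>\<^bsub>quotient_module M L\<^esub> X"
        unfolding XY using u v by (simp add: L.a_rcos_sum M.a_comm)
      fix Z assume "Z \<in> carrier (quotient_module M L)"
      then obtain w where w: "w \<in> carrier M" "Z = L +>\<^bsub>M\<^esub> w" by (elim quotient_cosetE)
      show "X \<oplus>\<^bsub>quotient_module M L\<^esub> Y \<oplus>\<^bsub>quotient_module M L\<^esub> Z =
          X \<oplus>\<^bsub>quotient_module M L\<^esub> (Y \<oplus>\<^bsub>quotient_module M L\<^esub> Z)"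
        using u v w by (simp add: L.a_rcos_sum M.a_assoc)
    qed
  next
    fix a X assume a: "a \<in> carrier R" and "X \<in> carrier (quotient_module M L)"
    then obtain u where u: "u \<in> carrier M" "X = L +>\<^bsub>M\<^esub> u" by (elim quotient_cosetE)
    show "a \<odot>\<^bsub>quotient_module M L\<^esub> X \<in> carrier (quotient_module M L)"
      unfolding u(2) quotient_smult_coset[OF L a u(1)] using a u(1)
      by (intro coset_in_quotient smult_closed)
  next
    fix a b X assume ab: "a \<in> carrier R" "b \<in> carrier R" and "X \<in> carrier (quotient_module M L)"
    then obtain u where u: "u \<in> carrier M" "X = L +>\<^bsub>M\<^esub> u" by (elim quotient_cosetE)
    show "(a \<oplus> b) \<odot>\<^bsub>quotient_module M L\<^esub> X =
        a \<odot>\<^bsub>quotient_module M L\<^esub> X \<oplus>\<^bsub>quotient_module M L\<^esub> b \<odot>\<^bsub>quotient_module M L\<^esub> X"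
      using ab u by (simp add: quotient_smult_coset[OF L] L.a_rcos_sum smult_l_distr)
    show "(a \<otimes> b) \<odot>\<^bsub>quotient_module M L\<^esub> X =
        a \<odot>\<^bsub>quotient_module M L\<^esub> (b \<odot>\<^bsub>quotient_module M L\<^esub> X)"
      using ab u by (simp add: quotient_smult_coset[OF L] smult_assoc1)
  next
    fix a X Y assume a: "a \<in> carrier R"
      and "X \<in> carrier (quotient_module M L)" "Y \<in> carrier (quotient_module M L)"
    then obtain u v where u: "u \<in> carrier M" "X = L +>\<^bsub>M\<^esub> u" and v: "v \<in> carrier M" "Y = L +>\<^bsub>M\<^esub> v"
      by (elim quotient_cosetE)
    show "a \<odot>\<^bsub>quotient_module M L\<^esub> (X \<oplus>\<^bsub>quotient_module M L\<^esub> Y) =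
        a \<odot>\<^bsub>quotient_module M L\<^esub> X \<oplus>\<^bsub>quotient_module M L\<^esub> a \<odot>\<^bsub>quotient_module M L\<^esub> Y"
      using a u v by (simp add: quotient_smult_coset[OF L] L.a_rcos_sum smult_r_distr)
  next
    fix X assume "X \<in> carrier (quotient_module M L)"
    then obtain u where u: "u \<in> carrier M" "X = L +>\<^bsub>M\<^esub> u" by (elim quotient_cosetE)
    then show "\<one> \<odot>\<^bsub>quotient_module M L\<^esub> X = X"
      by (simp add: quotient_smult_coset[OF L])
  qed
qed

end

section \<open>Linear maps and cyclic submodules\<close>

lemma linear_maps_zero:
  assumes "module R M" "module R N" "h \<in> linear_maps R M N"
  shows "h \<zero>\<^bsub>M\<^esub> = \<zero>\<^bsub>N\<^esub>"
proof -
  interpret M: module R M by fact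
  interpret N: module R N by fact
  have h0: "h \<zero>\<^bsub>M\<^esub> \<in> carrier N" using assms(3) by (auto simp: linear_maps_def)
  have add: "h (u \<oplus>\<^bsub>M\<^esub> v) = h u \<oplus>\<^bsub>N\<^esub> h v" if "u \<in> carrier M" "v \<in> carrier M" for u v
    using assms(3) that by (simp add: linear_maps_def)
  have "h \<zero>\<^bsub>M\<^esub> \<oplus>\<^bsub>N\<^esub> h \<zero>\<^bsub>M\<^esub> = h \<zero>\<^bsub>M\<^esub>"
    using add[OF M.M.zero_closed M.M.zero_closed] by (metis M.M.r_zero M.M.zero_closed)
  then show ?thesis using N.M.add.l_cancel_one[OF h0 h0] by metis
qed

lemma cyclic_submodule:
  assumes "module R M" and u: "u \<in> carrier M"
  shows "submodule {r \<odot>\<^bsub>M\<^esub> u |r. r \<in> carrier R} R M"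
proof -
  interpret M: module R M by fact
  show ?thesis
  proof (rule M.submoduleI)
    show "\<zero>\<^bsub>M\<^esub> \<in> {r \<odot>\<^bsub>M\<^esub> u |r. r \<in> carrier R}"
      using M.smult_l_null[OF u] M.R.zero_closed by force
    show "\<ominus>\<^bsub>M\<^esub> v \<in> {r \<odot>\<^bsub>M\<^esub> u |r. r \<in> carrier R}"
      if v: "v \<in> {r \<odot>\<^bsub>M\<^esub> u |r. r \<in> carrier R}" for v
    proof -
      obtain r where r: "r \<in> carrier R" "v = r \<odot>\<^bsub>M\<^esub> u" using v by blast
      then have "\<ominus>\<^bsub>M\<^esub> v = (\<ominus>\<^bsub>R\<^esub> r) \<odot>\<^bsub>M\<^esub> u" using M.smult_l_minus[OF r(1) u] by simp
      then show ?thesis using M.R.a_inv_closed[OF r(1)] by blast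
    qed
    show "v \<oplus>\<^bsub>M\<^esub> w \<in> {r \<odot>\<^bsub>M\<^esub> u |r. r \<in> carrier R}"
      if vw: "v \<in> {r \<odot>\<^bsub>M\<^esub> u |r. r \<in> carrier R}" "w \<in> {r \<odot>\<^bsub>M\<^esub> u |r. r \<in> carrier R}" for v w
    proof -
      obtain r s where r: "r \<in> carrier R" "v = r \<odot>\<^bsub>M\<^esub> u" and s: "s \<in> carrier R" "w = s \<odot>\<^bsub>M\<^esub> u"
        using vw by blast
      then have "v \<oplus>\<^bsub>M\<^esub> w = (r \<oplus>\<^bsub>R\<^esub> s) \<odot>\<^bsub>M\<^esub> u" using M.smult_l_distr[OF r(1) s(1) u] by simp
      then show ?thesis using M.R.a_closed[OF r(1) s(1)] by blast
    qed
    show "a \<odot>\<^bsub>M\<^esub> v \<in> {r \<odot>\<^bsub>M\<^esub> u |r. r \<in> carrier R}"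
      if a: "a \<in> carrier R" and v: "v \<in> {r \<odot>\<^bsub>M\<^esub> u |r. r \<in> carrier R}" for a v
    proof -
      obtain r where r: "r \<in> carrier R" "v = r \<odot>\<^bsub>M\<^esub> u" using v by blast
      then have "a \<odot>\<^bsub>M\<^esub> v = (a \<otimes>\<^bsub>R\<^esub> r) \<odot>\<^bsub>M\<^esub> u" using M.smult_assoc1[OF a r(1) u] by simp
      then show ?thesis using M.R.m_closed[OF a r(1)] by blast
    qed
  qed (use u in auto)
qed

text \<open>If the annihilator of \<open>u\<close> also kills \<open>e\<close>, then the rule that
  sends \<open>r u\<close> to \<open>r e\<close> is well defined. This produces the map on a cyclic
  submodule that injectivity of \<open>E\<close> later extends.\<close>

lemma cyclic_submodule_map:
  assumes "module R M" "module R E" and u: "u \<in> carrier M" and e: "e \<in> carrier E"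
    and ann: "\<And>r. r \<in> carrier R \<Longrightarrow> r \<odot>\<^bsub>M\<^esub> u = \<zero>\<^bsub>M\<^esub> \<Longrightarrow> r \<odot>\<^bsub>E\<^esub> e = \<zero>\<^bsub>E\<^esub>"
  obtains f where "f \<in> linear_maps R (M\<lparr>carrier := {r \<odot>\<^bsub>M\<^esub> u |r. r \<in> carrier R}\<rparr>) E"
    and "f u = e"
proof -
  interpret M: module R M by fact
  interpret E: module R E by fact
  have wd: "r \<odot>\<^bsub>E\<^esub> e = s \<odot>\<^bsub>E\<^esub> e"
    if rs: "r \<in> carrier R" "s \<in> carrier R" and eq: "r \<odot>\<^bsub>M\<^esub> u = s \<odot>\<^bsub>M\<^esub> u" for r s
  proof -
    have ns: "\<ominus>\<^bsub>R\<^esub> s \<in> carrier R" using rs by (intro M.R.a_inv_closed)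
    have "(r \<oplus>\<^bsub>R\<^esub> \<ominus>\<^bsub>R\<^esub> s) \<odot>\<^bsub>M\<^esub> u = r \<odot>\<^bsub>M\<^esub> u \<oplus>\<^bsub>M\<^esub> \<ominus>\<^bsub>M\<^esub> (s \<odot>\<^bsub>M\<^esub> u)"
      using M.smult_l_distr[OF rs(1) ns u] M.smult_l_minus[OF rs(2) u] by simp
    also have "\<dots> = \<zero>\<^bsub>M\<^esub>" unfolding eq using rs u by (intro M.M.r_neg M.smult_closed)
    finally have "(r \<oplus>\<^bsub>R\<^esub> \<ominus>\<^bsub>R\<^esub> s) \<odot>\<^bsub>E\<^esub> e = \<zero>\<^bsub>E\<^esub>"
      using rs ns by (intro ann M.R.a_closed)
    then have "r \<odot>\<^bsub>E\<^esub> e \<oplus>\<^bsub>E\<^esub> \<ominus>\<^bsub>E\<^esub> (s \<odot>\<^bsub>E\<^esub> e) = \<zero>\<^bsub>E\<^esub>"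
      using E.smult_l_distr[OF rs(1) ns e] E.smult_l_minus[OF rs(2) e] by simp
    then show ?thesis
      using E.M.minus_equality[of "r \<odot>\<^bsub>E\<^esub> e" "\<ominus>\<^bsub>E\<^esub> (s \<odot>\<^bsub>E\<^esub> e)"] rs e by simp
  qed
  \<comment> \<open>A coefficient is chosen for each element of the cyclic submodule; by
    \<open>wd\<close> the value does not depend on the choice.\<close>
  define f where "f v = (SOME r. r \<in> carrier R \<and> v = r \<odot>\<^bsub>M\<^esub> u) \<odot>\<^bsub>E\<^esub> e" for v
  have f: "f (r \<odot>\<^bsub>M\<^esub> u) = r \<odot>\<^bsub>E\<^esub> e" if r: "r \<in> carrier R" for r
  proof -
    define s where "s = (SOME s. s \<in> carrier R \<and> r \<odot>\<^bsub>M\<^esub> u = s \<odot>\<^bsub>M\<^esub> u)"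
    have s: "s \<in> carrier R \<and> r \<odot>\<^bsub>M\<^esub> u = s \<odot>\<^bsub>M\<^esub> u"
      unfolding s_def by (rule someI[of _ r]) (use r in simp)
    have "f (r \<odot>\<^bsub>M\<^esub> u) = s \<odot>\<^bsub>E\<^esub> e" by (simp only: f_def s_def)
    also have "\<dots> = r \<odot>\<^bsub>E\<^esub> e" using s by (intro wd[OF _ r]) (elim conjE, simp only:)+
    finally show ?thesis .
  qed
  show thesis
  proof (rule that)
    let ?N = "{r \<odot>\<^bsub>M\<^esub> u |r. r \<in> carrier R}"
    have mem: "f v \<in> carrier E" if v: "v \<in> ?N" for v
    proof -
      obtain r where r: "r \<in> carrier R" "v = r \<odot>\<^bsub>M\<^esub> u" using v by blast
      show ?thesis unfolding r(2) f[OF r(1)] by (rule E.smult_closed[OF r(1) e])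
    qed
    have add: "f (v \<oplus>\<^bsub>M\<^esub> w) = f v \<oplus>\<^bsub>E\<^esub> f w" if vw: "v \<in> ?N" "w \<in> ?N" for v w
    proof -
      obtain r s where r: "r \<in> carrier R" "v = r \<odot>\<^bsub>M\<^esub> u" and s: "s \<in> carrier R" "w = s \<odot>\<^bsub>M\<^esub> u"
        using vw by blast
      show ?thesis
        unfolding r(2) s(2) M.smult_l_distr[OF r(1) s(1) u, symmetric] f[OF r(1)] f[OF s(1)]
          f[OF M.R.a_closed[OF r(1) s(1)]] by (rule E.smult_l_distr[OF r(1) s(1) e])
    qed
    have smult: "f (a \<odot>\<^bsub>M\<^esub> v) = a \<odot>\<^bsub>E\<^esub> f v" if a: "a \<in> carrier R" and v: "v \<in> ?N" for a v
    proof -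
      obtain r where r: "r \<in> carrier R" "v = r \<odot>\<^bsub>M\<^esub> u" using v by blast
      show ?thesis
        unfolding r(2) M.smult_assoc1[OF a r(1) u, symmetric] f[OF r(1)]
          f[OF M.R.m_closed[OF a r(1)]] by (rule E.smult_assoc1[OF a r(1) e])
    qed
    \<comment> \<open>Naming the set keeps the simplifier from taking its comprehension
      apart.\<close>
    define N where "N = ?N"
    show "f \<in> linear_maps R (M\<lparr>carrier := ?N\<rparr>) E"
      using mem add smult unfolding linear_maps_def N_def[symmetric] by simp
    show "f u = e" using f[OF M.R.one_closed] u e by simp
  qed
qed

lemma module_regular_module:
  assumes "cring R"
  shows "module R (regular_module R)"
proof -
  interpret cring R by fact
  have "abelian_group (regular_module R)"
  proof (rule abelian_groupI)
    fix x assume "x \<in> carrier (regular_module R)"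
    then show "\<exists>y\<in>carrier (regular_module R). y \<oplus>\<^bsub>regular_module R\<^esub> x = \<zero>\<^bsub>regular_module R\<^esub>"
      by (intro bexI[of _ "\<ominus>\<^bsub>R\<^esub> x"]) (simp_all add: regular_module_def l_neg)
  qed (simp_all add: regular_module_def a_ac)
  then show ?thesis
    using assms by (intro moduleI) (auto simp: regular_module_def l_distr r_distr m_assoc)
qed

section \<open>Module closures\<close>

lemma subgroup_tensor_relations:
  assumes "module R B" "module R M"
  shows "subgroup (tensor_relations R B M) (tensor_free B M)"
proof -
  interpret B: module R B by fact
  interpret M: module R M by fact
  interpret F: group "tensor_free B M" by (simp add: tensor_free_def)
  have frag: "frag_of p \<in> carrier (tensor_free B M)" if "p \<in> carrier B \<times> carrier M" for p
    using that by (simp add: tensor_free_def)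
  have minus: "c - c' \<in> carrier (tensor_free B M)"
    if "c \<in> carrier (tensor_free B M)" "c' \<in> carrier (tensor_free B M)" for c c'
    using that keys_diff[of c c'] by (auto simp: tensor_free_def)
  show ?thesis
    unfolding tensor_relations_def
    by (rule F.generate_is_subgroup) (auto simp: minus frag)
qed

text \<open>The elements that \<open>h\<close> sends to zero form a subgroup of the free group.
  Balancedness puts the generators of the relations into it, hence the whole subgroup that they
  generate.\<close>

lemma tensor_relations_kernel:
  fixes h :: "('b \<times> 'm \<Rightarrow>\<^sub>0 int) \<Rightarrow> 'c::ab_group_add"
  assumes B: "module R B" and M: "module R M"
    and add: "\<And>c c'. c \<in> carrier (tensor_free B M) \<Longrightarrow> c' \<in> carrier (tensor_free B M) \<Longrightarrow>
      h (c + c') = h c + h c'"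
    and h1: "\<And>b b' u. b \<in> carrier B \<Longrightarrow> b' \<in> carrier B \<Longrightarrow> u \<in> carrier M \<Longrightarrow>
      h (frag_of (b \<oplus>\<^bsub>B\<^esub> b', u)) = h (frag_of (b, u)) + h (frag_of (b', u))"
    and h2: "\<And>b u u'. b \<in> carrier B \<Longrightarrow> u \<in> carrier M \<Longrightarrow> u' \<in> carrier M \<Longrightarrow>
      h (frag_of (b, u \<oplus>\<^bsub>M\<^esub> u')) = h (frag_of (b, u)) + h (frag_of (b, u'))"
    and h3: "\<And>r b u. r \<in> carrier R \<Longrightarrow> b \<in> carrier B \<Longrightarrow> u \<in> carrier M \<Longrightarrow>
      h (frag_of (r \<odot>\<^bsub>B\<^esub> b, u)) = h (frag_of (b, r \<odot>\<^bsub>M\<^esub> u))"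
    and c: "c \<in> tensor_relations R B M"
  shows "h c = 0"
proof -
  interpret B: module R B by fact
  interpret M: module R M by fact
  interpret F: group "tensor_free B M" by (simp add: tensor_free_def)
  have mult: "c \<otimes>\<^bsub>tensor_free B M\<^esub> c' = c + c'" for c c' by (simp add: tensor_free_def)
  have one: "\<one>\<^bsub>tensor_free B M\<^esub> = 0" by (simp add: tensor_free_def)
  have frag: "frag_of p \<in> carrier (tensor_free B M)" if "p \<in> carrier B \<times> carrier M" for p
    using that by (simp add: tensor_free_def)
  have minus: "c - c' \<in> carrier (tensor_free B M)"
    if "c \<in> carrier (tensor_free B M)" "c' \<in> carrier (tensor_free B M)" for c c'
    using that keys_diff[of c c'] by (auto simp: tensor_free_def)
  have diff: "h (c - c') = h c - h c'"
    if "c \<in> carrier (tensor_free B M)" "c' \<in> carrier (tensor_free B M)" for c c'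
    using add[OF minus[OF that] that(2)] by simp
  have zero: "h 0 = 0" using diff[of 0 0] F.one_closed one by simp
  define A where "A = {c \<in> carrier (tensor_free B M). h c = 0}"
  have "subgroup A (tensor_free B M)"
  proof (rule F.subgroupI)
    show "A \<noteq> {}" using F.one_closed one zero by (auto simp: A_def)
    fix c assume c: "c \<in> A"
    have "inv\<^bsub>tensor_free B M\<^esub> c = 0 - c" using c by (simp add: A_def tensor_free_def)
    then show "inv\<^bsub>tensor_free B M\<^esub> c \<in> A"
      using c diff[of 0 c] minus[of 0 c] F.one_closed one zero by (auto simp: A_def)
  next
    fix c c' assume "c \<in> A" "c' \<in> A"
    then show "c \<otimes>\<^bsub>tensor_free B M\<^esub> c' \<in> A"
      using F.m_closed[of c c'] by (auto simp: A_def mult add)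
  qed (auto simp: A_def)
  then have "tensor_relations R B M \<subseteq> A"
    unfolding tensor_relations_def
    by (rule F.generate_subgroup_incl[rotated])
      (auto simp: A_def minus frag diff h1 h2 h3)
  then show ?thesis using c by (auto simp: A_def)
qed

text \<open>A balanced pairing that vanishes on \<open>L\<close> extends to formal sums, kills the
  relations, and kills everything that comes from the tensor product with \<open>L\<close>. It
  therefore vanishes on the closure of \<open>L\<close>, which is how elements are shown to lie
  outside a closure.\<close>

lemma module_closure_pairing_zero:
  fixes \<phi> :: "'b \<Rightarrow> 'm \<Rightarrow> 'c::ab_group_add"
  assumes B: "module R B" and M: "module R M" and L: "submodule L R M"
    and add_left: "\<And>b b' u. b \<in> carrier B \<Longrightarrow> b' \<in> carrier B \<Longrightarrow> u \<in> carrier M \<Longrightarrow>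
      \<phi> (b \<oplus>\<^bsub>B\<^esub> b') u = \<phi> b u + \<phi> b' u"
    and add_right: "\<And>b u u'. b \<in> carrier B \<Longrightarrow> u \<in> carrier M \<Longrightarrow> u' \<in> carrier M \<Longrightarrow>
      \<phi> b (u \<oplus>\<^bsub>M\<^esub> u') = \<phi> b u + \<phi> b u'"
    and balanced: "\<And>r b u. r \<in> carrier R \<Longrightarrow> b \<in> carrier B \<Longrightarrow> u \<in> carrier M \<Longrightarrow>
      \<phi> (r \<odot>\<^bsub>B\<^esub> b) u = \<phi> b (r \<odot>\<^bsub>M\<^esub> u)"
    and L_zero: "\<And>b v. b \<in> carrier B \<Longrightarrow> v \<in> L \<Longrightarrow> \<phi> b v = 0"
    and u: "u \<in> module_closure R B M L" and b: "b \<in> carrier B"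
  shows "\<phi> b u = 0"
proof -
  interpret B: module R B by fact
  interpret M: module R M by fact
  define N where "N = M\<lparr>carrier := L\<rparr>"
  have N_sel [simp]: "carrier N = L" "add N = add M" "smult N = smult M"
    by (simp_all add: N_def)
  have N: "module R N"
    unfolding N_def using L M by (rule submodule.submodule_is_module)
  have LM: "L \<subseteq> carrier M" using L by (rule M.submoduleE)
  have uM: "u \<in> carrier M" using u by (simp add: module_closure_def)
  \<comment> \<open>The value group is rewritten as a record so that the universal property of the
    free abelian group applies to it.\<close>
  define G :: "'c monoid" where "G = \<lparr>carrier = UNIV, monoid.mult = (+), one = 0\<rparr>"
  interpret G: comm_group G
  proof (rule comm_groupI)
    fix x assume "x \<in> carrier G"
    show "\<exists>y\<in>carrier G. y \<otimes>\<^bsub>G\<^esub> x = \<one>\<^bsub>G\<^esub>" by (rule bexI[of _ "- x"]) (simp_all add: G_def)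
  qed (simp_all add: G_def algebra_simps)
  obtain h where hom: "h \<in> hom (free_Abelian_group (carrier B \<times> carrier M)) G"
    and h: "\<And>x. x \<in> carrier B \<times> carrier M \<Longrightarrow> h (frag_of x) = (case x of (b, u) \<Rightarrow> \<phi> b u)"
    using G.free_Abelian_group_universal[of "\<lambda>(b, u). \<phi> b u" "carrier B \<times> carrier M"]
    by (auto simp: G_def)
  have add: "h (c + c') = h c + h c'"
    if "c \<in> carrier (tensor_free B M)" "c' \<in> carrier (tensor_free B M)" for c c'
    using hom_mult[OF hom] that by (simp add: G_def tensor_free_def)
  have sub: "carrier (tensor_free B N) \<subseteq> carrier (tensor_free B M)"
    using LM Sigma_mono[of "carrier B" "carrier B" "\<lambda>_. L" "\<lambda>_. carrier M"]
    by (auto simp: tensor_free_def simp del: Sigma_mono)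
  have rel: "h c = 0" if "c \<in> tensor_relations R B M" for c
    by (rule tensor_relations_kernel[OF B M _ _ _ _ that]) (auto simp: add h add_left add_right balanced)
  have rel': "h c = 0" if "c \<in> tensor_relations R B N" for c
  proof (rule tensor_relations_kernel[OF B N _ _ _ _ that], unfold N_sel)
    fix b b' v assume "b \<in> carrier B" "b' \<in> carrier B" "v \<in> L"
    then show "h (frag_of (b \<oplus>\<^bsub>B\<^esub> b', v)) = h (frag_of (b, v)) + h (frag_of (b', v))"
      using subsetD[OF LM] by (simp add: h add_left)
  next
    fix b v v' assume "b \<in> carrier B" "v \<in> L" "v' \<in> L"
    then show "h (frag_of (b, v \<oplus>\<^bsub>M\<^esub> v')) = h (frag_of (b, v)) + h (frag_of (b, v'))"
      using subsetD[OF LM] by (simp add: h add_right)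
  next
    fix r b v assume "r \<in> carrier R" "b \<in> carrier B" "v \<in> L"
    then show "h (frag_of (r \<odot>\<^bsub>B\<^esub> b, v)) = h (frag_of (b, r \<odot>\<^bsub>M\<^esub> v))"
      using subsetD[OF LM] by (simp add: h balanced)
  qed (use add sub in blast)
  \<comment> \<open>Formal sums on \<open>carrier B \<times> L\<close> arise from symbols by
    differences, and \<open>h\<close> vanishes on each symbol by \<open>L_zero\<close>.\<close>
  have zero: "h c = 0" if "Poly_Mapping.keys c \<subseteq> carrier B \<times> L" for c
  proof (rule free_Abelian_group_induct[where P = "\<lambda>c. h c = 0", OF that])
    have "h (0 + 0) = h 0 + h 0" by (rule add) (simp_all add: tensor_free_def)
    then show "h 0 = 0" by simp
  next
    fix c c'
    assume c: "Poly_Mapping.keys c \<subseteq> carrier B \<times> L" "Poly_Mapping.keys c' \<subseteq> carrier B \<times> L"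
      and h0: "h c = 0" "h c' = 0"
    have "c - c' \<in> carrier (tensor_free B N)"
      using c keys_diff[of c c'] unfolding tensor_free_def carrier_free_Abelian_group_iff N_sel
      by blast
    moreover have "c' \<in> carrier (tensor_free B N)" using c by (simp add: tensor_free_def)
    ultimately have "h (c - c' + c') = h (c - c') + h c'" using sub by (intro add) blast+
    then show "h (c - c') = 0" using h0 by simp
  next
    fix a assume "a \<in> carrier B \<times> L"
    then show "h (frag_of a) = 0" using subsetD[OF LM] by (cases a) (simp add: h L_zero)
  qed
  have "pure_tensor R B M b u \<in> tensor_incl R B M ` carrier (tensor_product R B N)"
    using u b by (simp add: module_closure_def N_def)
  then obtain c where c: "c \<in> carrier (tensor_free B N)"
    and eq: "pure_tensor R B M b u =
      tensor_incl R B M (tensor_relations R B N #>\<^bsub>tensor_free B N\<^esub> c)"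
    by (auto simp: tensor_product_def FactGroup_def RCOSETS_def)
  \<comment> \<open>Since zero is a relation, the coset of \<open>b \<otimes> u\<close> contains the
    symbol \<open>frag_of (b, u)\<close> itself. Membership in the image splits this symbol into a
    relation over \<open>M\<close>, a relation over \<open>L\<close>, and a formal sum on
    \<open>carrier B \<times> L\<close>.\<close>
  have "0 \<in> tensor_relations R B M"
    unfolding tensor_relations_def using generate.one[of "tensor_free B M"]
    by (simp add: tensor_free_def)
  then have "frag_of (b, u) \<in> pure_tensor R B M b u"
    by (force simp: pure_tensor_def r_coset_def tensor_free_def)
  then obtain r r' where r: "r \<in> tensor_relations R B M" "r' \<in> tensor_relations R B N"
    and sum: "frag_of (b, u) = r + (r' + c)"
    unfolding eq by (auto simp: tensor_incl_def set_mult_def r_coset_def tensor_free_def)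
  interpret F: group "tensor_free B M" by (simp add: tensor_free_def)
  have carr: "r \<in> carrier (tensor_free B M)" "r' \<in> carrier (tensor_free B M)"
      "c \<in> carrier (tensor_free B M)"
    using r c sub subgroup.subset[OF subgroup_tensor_relations[OF B M]]
      subgroup.subset[OF subgroup_tensor_relations[OF B N]] by blast+
  have "r' + c \<in> carrier (tensor_free B M)"
    using F.m_closed[OF carr(2,3)] by (simp add: tensor_free_def)
  then have "h (frag_of (b, u)) = h r + (h r' + h c)"
    unfolding sum using add[OF carr(1)] add[OF carr(2,3)] by metis
  also have "\<dots> = 0"
    using c by (simp add: rel[OF r(1)] rel'[OF r(2)] zero tensor_free_def)
  finally show ?thesis using b uM by (simp add: h)
qed

text \<open>If all tensors \<open>b \<otimes> u\<close> vanish, each is the image of the zero of the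
  tensor product with \<open>L\<close>. It has to be checked that the induced map sends the zero
  coset to the zero coset, which holds because relations over \<open>L\<close> are relations over
  \<open>M\<close>.\<close>

lemma pure_tensor_eq_zero_imp_module_closure:
  assumes B: "module R B" and M: "module R M" and L: "submodule L R M"
    and u: "u \<in> carrier M"
    and zero: "\<And>b. b \<in> carrier B \<Longrightarrow> frag_of (b, u) \<in> tensor_relations R B M"
  shows "u \<in> module_closure R B M L"
  unfolding module_closure_def
proof (intro CollectI conjI ballI)
  interpret F: group "tensor_free B M" by (simp add: tensor_free_def)
  interpret M: module R M by fact
  define N where "N = M\<lparr>carrier := L\<rparr>"
  have N: "module R N"
    unfolding N_def using L M by (rule submodule.submodule_is_module)
  have LM: "L \<subseteq> carrier M" using L by (rule M.submoduleE)
  interpret FL: group "tensor_free B N" by (simp add: tensor_free_def)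
  interpret T: subgroup "tensor_relations R B M" "tensor_free B M"
    using B M by (rule subgroup_tensor_relations)
  interpret TL: subgroup "tensor_relations R B N" "tensor_free B N"
    using B N by (rule subgroup_tensor_relations)
  show "u \<in> carrier M" by (rule u)
  fix b assume b: "b \<in> carrier B"
  have zero_in: "0 \<in> tensor_relations R B N" "0 \<in> tensor_relations R B M"
    using TL.one_closed T.one_closed by (simp_all add: tensor_free_def)
  \<comment> \<open>With the set of second components as a parameter, the generators of both
    relation subgroups have one formula, which is monotone in \<open>V\<close>.\<close>
  define rels where "rels V = {frag_of (b \<oplus>\<^bsub>B\<^esub> b', u) - frag_of (b, u) - frag_of (b', u) |b b' u.
        b \<in> carrier B \<and> b' \<in> carrier B \<and> u \<in> V} \<union>
     {frag_of (b, u \<oplus>\<^bsub>M\<^esub> u') - frag_of (b, u) - frag_of (b, u') |b u u'.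
        b \<in> carrier B \<and> u \<in> V \<and> u' \<in> V} \<union>
     {frag_of (r \<odot>\<^bsub>B\<^esub> b, u) - frag_of (b, r \<odot>\<^bsub>M\<^esub> u) |r b u.
        r \<in> carrier R \<and> b \<in> carrier B \<and> u \<in> V}" for V
  have rels: "tensor_relations R B N = generate (tensor_free B N) (rels L)"
    "tensor_relations R B M = generate (tensor_free B M) (rels (carrier M))"
    by (simp_all add: tensor_relations_def rels_def N_def)
  have "rels L \<subseteq> rels (carrier M)"
    using LM unfolding rels_def by blast
  then have rels_rel: "h \<in> tensor_relations R B M" if "h \<in> rels L" for h
    unfolding rels(2) using that by (auto intro: generate.incl)
  have NM: "tensor_relations R B N \<subseteq> tensor_relations R B M"
  proof
    fix c assume "c \<in> tensor_relations R B N"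
    then show "c \<in> tensor_relations R B M"
      unfolding rels(1)
    proof (induction rule: generate.induct)
      case one
      then show ?case using zero_in(2) by (simp add: tensor_free_def)
    next
      case (incl h)
      then show ?case by (rule rels_rel)
    next
      \<comment> \<open>Inversion is negation in both free groups, but this description is available
        only for elements of the respective carrier.\<close>
      case (inv h)
      then have "h \<in> tensor_relations R B N" unfolding rels(1) by (rule generate.incl)
      then have "h \<in> carrier (tensor_free B N)" by (rule TL.mem_carrier)
      moreover have "h \<in> carrier (tensor_free B M)" using rels_rel[OF inv] by (rule T.mem_carrier)
      ultimately have "inv\<^bsub>tensor_free B N\<^esub> h = inv\<^bsub>tensor_free B M\<^esub> h"
        by (simp add: tensor_free_def)
      then show ?case using T.m_inv_closed[OF rels_rel[OF inv]] by simp
    next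
      case (eng h h')
      then show ?case using T.m_closed[OF eng.IH] by (simp add: tensor_free_def)
    qed
  qed
  have "tensor_incl R B M (tensor_relations R B N) = tensor_relations R B M"
  proof
    show "tensor_incl R B M (tensor_relations R B N) \<subseteq> tensor_relations R B M"
      unfolding tensor_incl_def set_mult_def using T.m_closed subsetD[OF NM] by blast
    show "tensor_relations R B M \<subseteq> tensor_incl R B M (tensor_relations R B N)"
    proof
      fix c assume "c \<in> tensor_relations R B M"
      moreover have "c = c \<otimes>\<^bsub>tensor_free B M\<^esub> 0" by (simp add: tensor_free_def)
      ultimately show "c \<in> tensor_incl R B M (tensor_relations R B N)"
        unfolding tensor_incl_def set_mult_def using zero_in by blast
    qed
  qed
  also have "\<dots> = pure_tensor R B M b u"
    unfolding pure_tensor_def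
    using F.coset_join2[OF _ T.subgroup_axioms zero[OF b]] T.mem_carrier[OF zero[OF b]] by simp
  finally have *: "tensor_incl R B M (tensor_relations R B N) = pure_tensor R B M b u" .
  have "tensor_relations R B N \<in> carrier (tensor_product R B N)"
    using FL.coset_mult_one[OF TL.subset] FL.one_closed
    by (force simp: tensor_product_def FactGroup_def RCOSETS_def)
  then show "pure_tensor R B M b u \<in>
      tensor_incl R B M ` carrier (tensor_product R B (M\<lparr>carrier := L\<rparr>))"
    using * by (auto simp: N_def)
qed

text \<open>Membership of \<open>frag_of (b, u)\<close> in the relations expresses
  \<open>b \<otimes> u = 0\<close>. These are the rules for computing with vanishing pure
  tensors.\<close>

lemma pure_tensor_relations:
  fixes B :: "('r, 'b) module" and M :: "('r, 'm) module"
  assumes "module R B" "module R M"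
  shows "\<lbrakk>b \<in> carrier B; b' \<in> carrier B; u \<in> carrier M;
      frag_of (b, u) \<in> tensor_relations R B M; frag_of (b', u) \<in> tensor_relations R B M\<rbrakk>
      \<Longrightarrow> frag_of (b \<oplus>\<^bsub>B\<^esub> b', u) \<in> tensor_relations R B M"
    and "b \<in> carrier B \<Longrightarrow> frag_of (b, \<zero>\<^bsub>M\<^esub>) \<in> tensor_relations R B M"
    and "\<lbrakk>r \<in> carrier R; b \<in> carrier B; u \<in> carrier M\<rbrakk> \<Longrightarrow>
      frag_of (r \<odot>\<^bsub>B\<^esub> b, u) \<in> tensor_relations R B M \<longleftrightarrow>
      frag_of (b, r \<odot>\<^bsub>M\<^esub> u) \<in> tensor_relations R B M"
proof -
  interpret M: module R M by fact
  interpret T: subgroup "tensor_relations R B M" "tensor_free B M"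
    using assms by (rule subgroup_tensor_relations)
  have add: "c + c' \<in> tensor_relations R B M"
    if "c \<in> tensor_relations R B M" "c' \<in> tensor_relations R B M" for c c'
    using T.m_closed[OF that] by (simp add: tensor_free_def)
  have minus: "- c \<in> tensor_relations R B M" if "c \<in> tensor_relations R B M" for c
    using T.m_inv_closed[OF that] T.mem_carrier[OF that] by (simp add: tensor_free_def)
  show "frag_of (b \<oplus>\<^bsub>B\<^esub> b', u) \<in> tensor_relations R B M"
    if "b \<in> carrier B" "b' \<in> carrier B" "u \<in> carrier M"
      and rel: "frag_of (b, u) \<in> tensor_relations R B M" "frag_of (b', u) \<in> tensor_relations R B M"
  proof -
    have "frag_of (b \<oplus>\<^bsub>B\<^esub> b', u) - frag_of (b, u) - frag_of (b', u) \<in> tensor_relations R B M"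
      unfolding tensor_relations_def using that(1-3) by (intro generate.incl) auto
    from add[OF this add[OF rel]] show ?thesis by (simp add: algebra_simps)
  qed
  show "frag_of (b, \<zero>\<^bsub>M\<^esub>) \<in> tensor_relations R B M" if "b \<in> carrier B"
  proof -
    \<comment> \<open>As the sum of two zeros is zero, this relation equals minus the symbol in
      question.\<close>
    have "frag_of (b, \<zero>\<^bsub>M\<^esub> \<oplus>\<^bsub>M\<^esub> \<zero>\<^bsub>M\<^esub>) - frag_of (b, \<zero>\<^bsub>M\<^esub>) - frag_of (b, \<zero>\<^bsub>M\<^esub>)
        \<in> tensor_relations R B M"
      unfolding tensor_relations_def using that M.zero_closed
      by (intro generate.incl) (rule UnI1, rule UnI2, blast)
    from minus[OF this] show ?thesis by simp
  qed
  show "frag_of (r \<odot>\<^bsub>B\<^esub> b, u) \<in> tensor_relations R B M \<longleftrightarrow>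
      frag_of (b, r \<odot>\<^bsub>M\<^esub> u) \<in> tensor_relations R B M"
    if "r \<in> carrier R" "b \<in> carrier B" "u \<in> carrier M"
  proof -
    have *: "frag_of (r \<odot>\<^bsub>B\<^esub> b, u) - frag_of (b, r \<odot>\<^bsub>M\<^esub> u) \<in> tensor_relations R B M"
      unfolding tensor_relations_def using that by (intro generate.incl) auto
    show ?thesis
    proof
      assume "frag_of (r \<odot>\<^bsub>B\<^esub> b, u) \<in> tensor_relations R B M"
      from add[OF minus[OF *] this] show "frag_of (b, r \<odot>\<^bsub>M\<^esub> u) \<in> tensor_relations R B M"
        by simp
    next
      assume "frag_of (b, r \<odot>\<^bsub>M\<^esub> u) \<in> tensor_relations R B M"
      from add[OF * this] show "frag_of (r \<odot>\<^bsub>B\<^esub> b, u) \<in> tensor_relations R B M" by simp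
    qed
  qed
qed

section \<open>Coefficients of power series in two variables\<close>

lemma fps2_eqI: "(\<And>p q. coeff2 f p q = coeff2 g p q) \<Longrightarrow> f = g"
  by (simp add: coeff2_def fps_eq_iff)

lemma coeff2_ps_x_mult: "coeff2 (ps_x ^ a * f) p q = (if a \<le> p then coeff2 f (p - a) q else 0)"
  by (simp add: coeff2_def ps_x_def fps_X_power_mult_nth)

lemma coeff2_ps_y_mult: "coeff2 (ps_y ^ b * f) p q = (if b \<le> q then coeff2 f p (q - b) else 0)"
  by (simp add: coeff2_def ps_y_def fps_X_power_mult_nth)

lemma coeff2_monom_mult:
  "coeff2 (ps_x ^ a * ps_y ^ b * f) p q =
    (if a \<le> p \<and> b \<le> q then coeff2 f (p - a) (q - b) else 0)"
  by (simp add: mult.assoc coeff2_ps_x_mult coeff2_ps_y_mult)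

lemma coeff2_monom:
  "coeff2 (ps_x ^ a * ps_y ^ b) p q = (if p = a \<and> q = b then 1 else 0)"
  using coeff2_monom_mult[of a b 1 p q] by auto

definition fps2 :: "(nat \<Rightarrow> nat \<Rightarrow> 'k) \<Rightarrow> 'k::field fps fps"
  where "fps2 c = Abs_fps (\<lambda>q. Abs_fps (\<lambda>p. c p q))"

lemma coeff2_fps2 [simp]: "coeff2 (fps2 c) p q = c p q"
  by (simp add: fps2_def coeff2_def)

lemma ps_power_nonzero: "(ps_x ^ a * ps_y ^ b :: 'k::field fps fps) \<noteq> 0"
proof
  assume "(ps_x ^ a * ps_y ^ b :: 'k fps fps) = 0"
  then have "coeff2 (ps_x ^ a * ps_y ^ b :: 'k fps fps) a b = 0" by (simp only: coeff2_simps)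
  then show False by (simp only: coeff2_monom) simp
qed


section \<open>The Veronese ring\<close>

lemma veronese_simps [simp]:
  "carrier (veronese d) = veronese_carrier d" "\<zero>\<^bsub>veronese d\<^esub> = 0" "\<one>\<^bsub>veronese d\<^esub> = 1"
  "f \<oplus>\<^bsub>veronese d\<^esub> g = f + g" "f \<otimes>\<^bsub>veronese d\<^esub> g = f * g"
  by (simp_all add: veronese_def)

lemma veronese_pow [simp]: "f [^]\<^bsub>veronese d\<^esub> (n::nat) = f ^ n"
  by (induction n) (simp_all add: nat_pow_def)

lemma veronese_closed:
  fixes f g :: "'k::field fps fps"
  assumes "d > 0"
  shows "(0 :: 'k fps fps) \<in> veronese_carrier d" "(1 :: 'k fps fps) \<in> veronese_carrier d"
    and "f \<in> veronese_carrier d \<Longrightarrow> g \<in> veronese_carrier d \<Longrightarrow> f + g \<in> veronese_carrier d"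
    and "f \<in> veronese_carrier d \<Longrightarrow> g \<in> veronese_carrier d \<Longrightarrow> f * g \<in> veronese_carrier d"
    and "f \<in> veronese_carrier d \<Longrightarrow> f ^ n \<in> veronese_carrier d"
    and "f \<in> veronese_carrier d \<Longrightarrow> - f \<in> veronese_carrier d"
proof -
  interpret cring "veronese d :: 'k fps fps ring" by (rule cring_veronese[OF assms])
  show "(0 :: 'k fps fps) \<in> veronese_carrier d" "(1 :: 'k fps fps) \<in> veronese_carrier d"
    using zero_closed one_closed by simp_all
  show "f \<in> veronese_carrier d \<Longrightarrow> g \<in> veronese_carrier d \<Longrightarrow> f + g \<in> veronese_carrier d"
    using a_closed[of f g] by simp
  show "f \<in> veronese_carrier d \<Longrightarrow> g \<in> veronese_carrier d \<Longrightarrow> f * g \<in> veronese_carrier d"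
    using m_closed[of f g] by simp
  show "f \<in> veronese_carrier d \<Longrightarrow> f ^ n \<in> veronese_carrier d"
    using nat_pow_closed[of f n] by simp
  show "f \<in> veronese_carrier d \<Longrightarrow> - f \<in> veronese_carrier d"
    by (simp add: veronese_carrier_iff[OF assms])
qed

lemma monom_in_veronese:
  assumes "d > 0" "d dvd a + b"
  shows "ps_x ^ a * ps_y ^ b \<in> veronese_carrier d"
  using assms by (auto simp: veronese_carrier_iff coeff2_monom)

text \<open>A series with nonzero constant term has an inverse in \<open>k[[x, y]]\<close>. The part
  of that inverse in degrees divisible by \<open>d\<close> is again an inverse and lies in the
  Veronese ring.\<close>

lemma veronese_Units:
  assumes d: "d > 0"
  shows "Units (veronese d :: 'k::field fps fps ring) = {f \<in> veronese_carrier d. coeff2 f 0 0 \<noteq> 0}"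
proof (intro equalityI subsetI)
  fix f :: "'k fps fps" assume "f \<in> Units (veronese d)"
  then obtain g where f: "f \<in> veronese_carrier d" and "g * f = 1" by (auto simp: Units_def)
  then have "coeff2 (g * f) 0 0 = 1" by simp
  then show "f \<in> {f \<in> veronese_carrier d. coeff2 f 0 0 \<noteq> 0}"
    using f by (auto simp: coeff2_mult)
next
  fix f :: "'k fps fps" assume "f \<in> {f \<in> veronese_carrier d. coeff2 f 0 0 \<noteq> 0}"
  then have f: "f \<in> veronese_carrier d" and "coeff2 f 0 0 \<noteq> 0" by auto
  \<comment> \<open>Regarded as a series in \<open>y\<close>, \<open>f\<close> has a leading
    coefficient in \<open>k[[x]]\<close> that is a unit, and this suffices to invert
    \<open>f\<close>.\<close>
  then have "fps_nth f 0 dvd 1" by (simp add: coeff2_def fps_is_unit_iff)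
  then obtain g0 where g0: "fps_nth f 0 * g0 = 1" by (metis dvdE)
  have "f * fps_right_inverse f g0 = 1" by (rule fps_right_inverse[OF g0])
  then obtain h where h: "f * h = 1" ..
  define g where "g = fps2 (\<lambda>p q. if d dvd p + q then coeff2 h p q else 0)"
  have g: "g \<in> veronese_carrier d"
    unfolding veronese_carrier_iff[OF d] g_def by simp
  \<comment> \<open>Multiplication by \<open>f\<close> preserves degrees modulo \<open>d\<close>.\<close>
  have "f * g = 1"
  proof (rule fps2_eqI)
    fix p q
    show "coeff2 (f * g) p q = coeff2 1 p q"
    proof (cases "d dvd p + q")
      case True
      have "coeff2 f i j * coeff2 g (p - i) (q - j) = coeff2 f i j * coeff2 h (p - i) (q - j)"
        if "j \<in> {..q}" "i \<in> {..p}" for i j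
      proof (cases "coeff2 f i j = 0")
        case False
        then have "d dvd i + j" using f unfolding veronese_carrier_iff[OF d] by blast
        then have "d dvd (p + q) - (i + j)" using True by simp
        also have "(p + q) - (i + j) = (p - i) + (q - j)" using that by simp
        finally show ?thesis by (simp add: g_def)
      qed simp
      then have "coeff2 (f * g) p q = coeff2 (f * h) p q"
        unfolding coeff2_mult by (intro sum.cong refl)
      then show ?thesis using h by simp
    next
      case False
      then show ?thesis
        using veronese_closed(4)[OF d f g] veronese_carrier_iff[OF d, of "f * g"] by (auto intro: ccontr)
    qed
  qed
  then show "f \<in> Units (veronese d)"
    using f g by (auto simp: Units_def mult.commute intro!: bexI[of _ g])
qed

section \<open>Localizations of the Veronese ring\<close>

locale veronese_localization =
  fixes d :: nat and g :: "'k::field fps fps"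
  assumes d: "d > 0" and g: "g \<in> veronese_carrier d" and g_nonzero: "g \<noteq> 0"
begin

abbreviation "R \<equiv> veronese d :: 'k fps fps ring"
abbreviation "C \<equiv> veronese_carrier d :: 'k fps fps set"
abbreviation "Loc \<equiv> localization (veronese d) g"

lemmas closed = veronese_closed[OF d] veronese_closed(5)[OF d g]

text \<open>In the domain \<open>k[[x, y]]\<close> the extra power of \<open>g\<close> in the
  definition of a fraction cancels, which leaves cross multiplication.\<close>

lemma mem_frac_iff: "(b, t) \<in> frac R g a s \<longleftrightarrow> b \<in> C \<and> g ^ t * a = g ^ s * b"
  using g_nonzero by (simp add: frac_def)

lemma frac_eq_iff:
  assumes "a \<in> C" "b \<in> C"
  shows "frac R g a s = frac R g b t \<longleftrightarrow> g ^ t * a = g ^ s * b"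
proof
  assume "frac R g a s = frac R g b t"
  \<comment> \<open>A fraction is the set of its representatives, so equal fractions share the
    representative \<open>(b, t)\<close>.\<close>
  moreover have "(b, t) \<in> frac R g b t" using assms by (simp add: mem_frac_iff)
  ultimately show "g ^ t * a = g ^ s * b" by (metis mem_frac_iff)
next
  assume eq: "g ^ t * a = g ^ s * b"
  \<comment> \<open>Transitivity of cross multiplication: multiply by \<open>g ^ t\<close>, replace
    \<open>a\<close> by means of \<open>eq\<close>, and cancel \<open>g ^ s\<close>.\<close>
  have "g ^ u * a = g ^ s * c \<longleftrightarrow> g ^ u * b = g ^ t * c" for c u
  proof -
    have 1: "g ^ t * (g ^ u * a) = g ^ s * (g ^ u * b)"
      using arg_cong[OF eq, of "\<lambda>x. g ^ u * x"] by (simp only: mult.left_commute)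
    have 2: "g ^ t * (g ^ s * c) = g ^ s * (g ^ t * c)" by (rule mult.left_commute)
    have "g ^ u * a = g ^ s * c \<longleftrightarrow> g ^ t * (g ^ u * a) = g ^ t * (g ^ s * c)"
      using g_nonzero by simp
    also have "\<dots> \<longleftrightarrow> g ^ s * (g ^ u * b) = g ^ s * (g ^ t * c)"
      unfolding 1 2 ..
    also have "\<dots> \<longleftrightarrow> g ^ u * b = g ^ t * c" using g_nonzero by simp
    finally show ?thesis .
  qed
  then show "frac R g a s = frac R g b t" by (auto simp: mem_frac_iff set_eq_iff)
qed

lemma frac_in_Loc: "a \<in> C \<Longrightarrow> frac R g a s \<in> carrier Loc"
  by (auto simp: localization_def)

lemma Loc_cases:
  assumes "X \<in> carrier Loc"
  obtains a s where "a \<in> C" "X = frac R g a s"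
  using assms by (auto simp: localization_def)

lemma zero_Loc: "\<zero>\<^bsub>Loc\<^esub> = frac R g 0 0"
  by (simp add: localization_def)

text \<open>Addition is a union over all pairs of representatives. Cross multiplication shows that
  each pair yields the same fraction, so the union collapses.\<close>

lemma add_frac:
  assumes "a \<in> C" "b \<in> C"
  shows "frac R g a s \<oplus>\<^bsub>Loc\<^esub> frac R g b t = frac R g (g ^ t * a + g ^ s * b) (s + t)"
proof -
  let ?r = "frac R g (g ^ t * a + g ^ s * b) (s + t)"
  have eq: "frac R g (g ^ v * a' + g ^ u * b') (u + v) = ?r"
    if "(a', u) \<in> frac R g a s" "(b', v) \<in> frac R g b t" for a' u b' v
  proof -
    have a': "a' \<in> C" "g ^ u * a = g ^ s * a'" and b': "b' \<in> C" "g ^ v * b = g ^ t * b'"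
      using that by (simp_all add: mem_frac_iff)
    have "g ^ (s + t) * (g ^ v * a' + g ^ u * b') =
        g ^ (t + v) * (g ^ s * a') + g ^ (s + u) * (g ^ t * b')"
      by (simp add: power_add algebra_simps)
    also have "\<dots> = g ^ (u + v) * (g ^ t * a + g ^ s * b)"
      unfolding a'(2)[symmetric] b'(2)[symmetric] by (simp add: power_add algebra_simps)
    finally show ?thesis
      using assms a' b' by (subst frac_eq_iff) (auto intro!: closed)
  qed
  have mem: "(a, s) \<in> frac R g a s" "(b, t) \<in> frac R g b t"
    using assms by (simp_all add: mem_frac_iff)
  have "frac R g a s \<oplus>\<^bsub>Loc\<^esub> frac R g b t =
      (\<Union>(a', u)\<in>frac R g a s. \<Union>(b', v)\<in>frac R g b t. frac R g (g ^ v * a' + g ^ u * b') (u + v))"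
    by (simp add: localization_def)
  also have "\<dots> = (\<Union>x\<in>frac R g a s. \<Union>y\<in>frac R g b t. ?r)"
    by (intro SUP_cong refl) (auto dest: eq)
  also have "\<dots> = ?r" using mem by blast
  finally show ?thesis .
qed

lemma smult_frac:
  assumes "r \<in> C" "a \<in> C"
  shows "r \<odot>\<^bsub>Loc\<^esub> frac R g a s = frac R g (r * a) s"
proof -
  have eq: "frac R g (r * a') u = frac R g (r * a) s" if "(a', u) \<in> frac R g a s" for a' u
  proof -
    have a': "a' \<in> C" "g ^ u * a = g ^ s * a'" using that by (simp_all add: mem_frac_iff)
    have "g ^ s * (r * a') = g ^ u * (r * a)"
      using arg_cong[OF a'(2), of "\<lambda>x. r * x"] by (simp only: mult.left_commute)
    then show ?thesis using assms a' by (subst frac_eq_iff) (auto intro!: closed)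
  qed
  have mem: "(a, s) \<in> frac R g a s" using assms by (simp add: mem_frac_iff)
  have "r \<odot>\<^bsub>Loc\<^esub> frac R g a s = (\<Union>(a', u)\<in>frac R g a s. frac R g (r * a') u)"
    by (simp add: localization_def)
  also have "\<dots> = (\<Union>x\<in>frac R g a s. frac R g (r * a) s)"
    by (intro SUP_cong refl) (auto dest: eq)
  also have "\<dots> = frac R g (r * a) s" using mem by blast
  finally show ?thesis .
qed

lemma module_Loc: "module R Loc"
proof (rule moduleI)
  show "cring R" by (rule cring_veronese[OF d])
  show "abelian_group Loc"
  proof (rule abelian_groupI)
    fix X Y assume "X \<in> carrier Loc" "Y \<in> carrier Loc"
    then obtain a s b t where a: "a \<in> C" "X = frac R g a s" and b: "b \<in> C" "Y = frac R g b t"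
      by (elim Loc_cases)
    show "X \<oplus>\<^bsub>Loc\<^esub> Y \<in> carrier Loc"
      unfolding a(2) b(2) add_frac[OF a(1) b(1)] using a b by (intro frac_in_Loc closed)
    show "X \<oplus>\<^bsub>Loc\<^esub> Y = Y \<oplus>\<^bsub>Loc\<^esub> X"
      using a b by (simp add: add_frac add.commute)
    fix Z assume "Z \<in> carrier Loc"
    then obtain c u where c: "c \<in> C" "Z = frac R g c u" by (elim Loc_cases)
    show "X \<oplus>\<^bsub>Loc\<^esub> Y \<oplus>\<^bsub>Loc\<^esub> Z = X \<oplus>\<^bsub>Loc\<^esub> (Y \<oplus>\<^bsub>Loc\<^esub> Z)"
      using a b c by (simp add: add_frac closed power_add algebra_simps)
  next
    show "\<zero>\<^bsub>Loc\<^esub> \<in> carrier Loc" unfolding zero_Loc by (intro frac_in_Loc closed)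
  next
    fix X assume "X \<in> carrier Loc"
    then obtain a s where a: "a \<in> C" "X = frac R g a s" by (elim Loc_cases)
    then show "\<zero>\<^bsub>Loc\<^esub> \<oplus>\<^bsub>Loc\<^esub> X = X" by (simp add: zero_Loc add_frac closed)
    have "frac R g (- a) s \<oplus>\<^bsub>Loc\<^esub> X = frac R g 0 (s + s)"
      using a by (simp add: add_frac closed)
    also have "\<dots> = \<zero>\<^bsub>Loc\<^esub>" by (simp add: zero_Loc frac_eq_iff closed)
    finally show "\<exists>Y\<in>carrier Loc. Y \<oplus>\<^bsub>Loc\<^esub> X = \<zero>\<^bsub>Loc\<^esub>"
      using a by (intro bexI[of _ "frac R g (- a) s"]) (auto intro!: frac_in_Loc closed)
  qed
next
  fix r X assume r: "r \<in> carrier R" and "X \<in> carrier Loc"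
  then obtain a s where a: "a \<in> C" "X = frac R g a s" by (elim Loc_cases)
  then show "r \<odot>\<^bsub>Loc\<^esub> X \<in> carrier Loc"
    using r by (auto simp: smult_frac intro!: frac_in_Loc closed)
next
  fix r r' X assume r: "r \<in> carrier R" "r' \<in> carrier R" and "X \<in> carrier Loc"
  then obtain a s where a: "a \<in> C" "X = frac R g a s" by (elim Loc_cases)
  show "(r \<oplus>\<^bsub>R\<^esub> r') \<odot>\<^bsub>Loc\<^esub> X = r \<odot>\<^bsub>Loc\<^esub> X \<oplus>\<^bsub>Loc\<^esub> r' \<odot>\<^bsub>Loc\<^esub> X"
    using r a by (simp add: smult_frac add_frac frac_eq_iff closed power_add algebra_simps)
  show "(r \<otimes>\<^bsub>R\<^esub> r') \<odot>\<^bsub>Loc\<^esub> X = r \<odot>\<^bsub>Loc\<^esub> (r' \<odot>\<^bsub>Loc\<^esub> X)"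
    using r a by (simp add: smult_frac closed mult.assoc)
next
  fix r X Y assume r: "r \<in> carrier R" and "X \<in> carrier Loc" "Y \<in> carrier Loc"
  then obtain a s b t where a: "a \<in> C" "X = frac R g a s" and b: "b \<in> C" "Y = frac R g b t"
    by (elim Loc_cases)
  show "r \<odot>\<^bsub>Loc\<^esub> (X \<oplus>\<^bsub>Loc\<^esub> Y) = r \<odot>\<^bsub>Loc\<^esub> X \<oplus>\<^bsub>Loc\<^esub> r \<odot>\<^bsub>Loc\<^esub> Y"
    using r a b by (simp add: smult_frac add_frac closed algebra_simps)
next
  fix X assume "X \<in> carrier Loc"
  then obtain a s where "a \<in> C" "X = frac R g a s" by (elim Loc_cases)
  then show "\<one>\<^bsub>R\<^esub> \<odot>\<^bsub>Loc\<^esub> X = X" by (simp add: smult_frac closed)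
qed

end

section \<open>Top local cohomology of the Veronese ring\<close>

locale veronese_cohomology =
  veronese_localization d "ps_x ^ d * ps_y ^ d :: 'k::field fps fps" for d
begin

abbreviation "g \<equiv> ps_x ^ d * ps_y ^ d :: 'k fps fps"
abbreviation "params \<equiv> [ps_x ^ d, ps_y ^ d] :: 'k fps fps list"
abbreviation "Bd \<equiv> cech_boundaries (veronese d :: 'k fps fps ring) params"
abbreviation "H \<equiv> top_local_cohomology (veronese d :: 'k fps fps ring) params"
abbreviation "cls a s \<equiv> Bd +>\<^bsub>Loc\<^esub> frac (veronese d) g a s"

lemma params_closed: "(ps_x ^ d :: 'k fps fps) \<in> C" "(ps_y ^ d :: 'k fps fps) \<in> C"
  using monom_in_veronese[OF d, of d 0, where 'a = 'k]
    monom_in_veronese[OF d, of 0 d, where 'a = 'k] by simp_all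

lemma closed_pow:
  assumes "a \<in> C"
  shows "a * ps_x ^ (d * s) \<in> C" "a * ps_y ^ (d * s) \<in> C"
  using assms by (simp_all add: closed params_closed power_mult)

lemma param_prod_eq: "param_prod R params = g"
proof -
  interpret cring R by (rule cring_veronese[OF d])
  have "{..<length params} = insert 0 (insert 1 {})" by auto
  then show ?thesis
    using params_closed unfolding param_prod_def by (simp add: Pi_def)
qed

lemma H_eq: "H = quotient_module Loc Bd"
  by (simp only: top_local_cohomology_def param_prod_eq)

lemma g_power: "g ^ n = ps_x ^ (d * n) * ps_y ^ (d * n)"
  by (simp add: power_mult_distrib power_mult)

lemma coeff2_g_power_mult:
  "coeff2 (g ^ n * f) p q = (if d * n \<le> p \<and> d * n \<le> q then coeff2 f (p - d * n) (q - d * n) else 0)"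
  unfolding g_power by (rule coeff2_monom_mult)

text \<open>The fraction \<open>a / g\<^sup>s\<close> has no monomial with two negative exponents.\<close>

definition low :: "'k fps fps \<Rightarrow> nat \<Rightarrow> bool"
  where "low a s \<longleftrightarrow> (\<forall>p<d * s. \<forall>q<d * s. coeff2 a p q = 0)"

lemma low_add:
  assumes "low a s" "low b t"
  shows "low (g ^ t * a + g ^ s * b) (s + t)"
  using assms
  by (auto simp: low_def coeff2_g_power_mult distrib_left less_diff_conv2 simp del: power_mult_distrib)

text \<open>Being \<open>low\<close> depends only on the fraction: a factor \<open>g ^ t\<close>
  shifts both exponents by \<open>d * t\<close>, exactly as much as the bound moves.\<close>

lemma low_frac_eq:
  assumes ab: "a \<in> C" "b \<in> C" and eq: "frac R g a s = frac R g b t" and low: "low b t"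
  shows "low a s"
  unfolding low_def
proof (intro allI impI)
  fix p q assume pq: "p < d * s" "q < d * s"
  have "coeff2 a p q = coeff2 (g ^ t * a) (p + d * t) (q + d * t)"
    by (simp add: coeff2_g_power_mult)
  also have "g ^ t * a = g ^ s * b" using eq ab by (simp only: frac_eq_iff)
  also have "coeff2 \<dots> (p + d * t) (q + d * t) = 0"
    using low pq by (auto simp: coeff2_g_power_mult low_def less_diff_conv2)
  finally show "coeff2 a p q = 0" .
qed

lemma cech_component_eq:
  "cech_component R params 0 = {frac R g (a * ps_x ^ (d * s)) s |a s. a \<in> C}"
  "cech_component R params 1 = {frac R g (a * ps_y ^ (d * s)) s |a s. a \<in> C}"
  unfolding cech_component_def param_prod_eq by (simp_all add: power_mult)

text \<open>The two Cech components are the fractions with denominator a power of \<open>y^d\<close>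
  and of \<open>x^d\<close>. A sum of two such fractions has no term with both exponents negative;
  conversely, each term of a \<open>low\<close> fraction belongs to one of the two
  components.\<close>

lemma frac_in_boundaries_iff:
  assumes f: "f \<in> C"
  shows "frac R g f s \<in> Bd \<longleftrightarrow> low f s"
proof
  interpret L: module R Loc by (rule module_Loc)
  have two: "{..<length params} = insert 0 (insert 1 {})" by auto
  {
    assume "frac R g f s \<in> Bd"
    then obtain v where v: "v 0 \<in> cech_component R params 0" "v 1 \<in> cech_component R params 1"
      and eq: "frac R g f s = (\<Oplus>\<^bsub>Loc\<^esub>i\<in>{..<length params}. v i)"
      unfolding cech_boundaries_def param_prod_eq by auto
    obtain a m b n where a: "a \<in> C" "v 0 = frac R g (a * ps_x ^ (d * m)) m"
      and b: "b \<in> C" "v 1 = frac R g (b * ps_y ^ (d * n)) n"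
      using v unfolding cech_component_eq by auto
    have "v 0 \<in> carrier Loc" "v 1 \<in> carrier Loc"
      unfolding a b using a(1) b(1) by (auto intro!: frac_in_Loc closed_pow)
    then have "frac R g f s = v 0 \<oplus>\<^bsub>Loc\<^esub> v 1"
      unfolding eq two by (simp add: Pi_def)
    also have "\<dots> = frac R g (g ^ n * (a * ps_x ^ (d * m)) + g ^ m * (b * ps_y ^ (d * n))) (m + n)"
      unfolding a(2) b(2) using a(1) b(1) by (intro add_frac closed_pow)
    finally have eq: "frac R g f s = \<dots>" .
    have "low (a * ps_x ^ (d * m)) m" "low (b * ps_y ^ (d * n)) n"
      by (auto simp: low_def mult.commute[of _ "_ ^ _"] coeff2_ps_x_mult coeff2_ps_y_mult)
    then show "low f s"
      using a(1) b(1) f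
      by (intro low_frac_eq[OF f _ eq] low_add closed closed_pow)
  next
    assume low: "low f s"
    \<comment> \<open>The series \<open>a\<close> collects the terms of \<open>f\<close> divisible
      by \<open>x ^ (d * s)\<close>, and \<open>b\<close> the remaining terms divisible by
      \<open>y ^ (d * s)\<close>. The test \<open>p < d * s\<close> prevents terms divisible by both
      from being counted twice.\<close>
    define a where "a = fps2 (\<lambda>p q. coeff2 f (p + d * s) q)"
    define b where "b = fps2 (\<lambda>p q. if p < d * s then coeff2 f p (q + d * s) else 0)"
    have dvd: "d dvd p + q" if "coeff2 f (p + d * s) q \<noteq> 0 \<or> coeff2 f p (q + d * s) \<noteq> 0" for p q
    proof -
      have "d dvd d * s + (p + q)"
        using that f unfolding veronese_carrier_iff[OF d]
        by (metis add.assoc add.commute)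
      then show ?thesis by (subst (asm) dvd_add_right_iff) auto
    qed
    have "a \<in> C" "b \<in> C"
      unfolding veronese_carrier_iff[OF d] a_def b_def by (auto intro: dvd split: if_splits)
    have f_eq: "f = a * ps_x ^ (d * s) + b * ps_y ^ (d * s)"
      by (rule fps2_eqI) (use low in \<open>auto simp: a_def b_def low_def
        mult.commute[of _ "_ ^ _"] coeff2_ps_x_mult coeff2_ps_y_mult\<close>)
    define v where "v i = (if i = 0 then frac R g (a * ps_x ^ (d * s)) s
      else frac R g (b * ps_y ^ (d * s)) s)" for i :: nat
    have "(\<Oplus>\<^bsub>Loc\<^esub>i\<in>{..<length params}. v i) =
        frac R g (a * ps_x ^ (d * s)) s \<oplus>\<^bsub>Loc\<^esub> frac R g (b * ps_y ^ (d * s)) s"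
      unfolding two using \<open>a \<in> C\<close> \<open>b \<in> C\<close>
      by (simp add: Pi_def v_def frac_in_Loc closed_pow)
    \<comment> \<open>The general sum formula doubles the exponent of the denominator; the common
      factor \<open>g ^ s\<close> cancels in the next step.\<close>
    also have "\<dots> = frac R g (g ^ s * f) (s + s)"
      unfolding f_eq using \<open>a \<in> C\<close> \<open>b \<in> C\<close>
      by (simp add: add_frac closed_pow distrib_left)
    also have "\<dots> = frac R g f s"
      using f by (simp add: frac_eq_iff closed power_add mult.assoc)
    finally have sum: "frac R g f s = (\<Oplus>\<^bsub>Loc\<^esub>i\<in>{..<length params}. v i)" ..
    have "v 0 \<in> cech_component R params 0" "v 1 \<in> cech_component R params 1"
      unfolding cech_component_eq v_def using \<open>a \<in> C\<close> \<open>b \<in> C\<close> by auto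
    then have "\<forall>i<length params. v i \<in> cech_component R params i"
      by (simp add: less_Suc_eq)
    then show "frac R g f s \<in> Bd"
      unfolding sum cech_boundaries_def param_prod_eq by blast
  }
qed

lemma boundaries_subset: "Bd \<subseteq> carrier Loc"
proof
  interpret L: module R Loc by (rule module_Loc)
  fix X assume "X \<in> Bd"
  then obtain v where v: "v 0 \<in> cech_component R params 0" "v 1 \<in> cech_component R params 1"
    and eq: "X = (\<Oplus>\<^bsub>Loc\<^esub>i\<in>{..<length params}. v i)"
    unfolding cech_boundaries_def param_prod_eq by auto
  have "v i \<in> carrier Loc" if "i \<in> {..<length params}" for i
    using v that unfolding cech_component_eq
    by (auto simp: less_Suc_eq intro!: frac_in_Loc closed_pow)
  then show "X \<in> carrier Loc" unfolding eq by (intro L.M.finsum_closed) auto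
qed

lemma boundaries_cases:
  assumes "X \<in> Bd"
  obtains a s where "a \<in> C" "low a s" "X = frac R g a s"
proof -
  obtain a s where "a \<in> C" "X = frac R g a s"
    using assms boundaries_subset by (blast elim: Loc_cases)
  with assms that show thesis by (simp add: frac_in_boundaries_iff)
qed

text \<open>Everything is read off from \<open>low\<close>: multiplication by a ring element never
  lowers exponents, and negation is multiplication by \<open>-1\<close>.\<close>

lemma submodule_boundaries: "submodule Bd R Loc"
proof -
  interpret L: module R Loc by (rule module_Loc)
  have smult: "r \<odot>\<^bsub>Loc\<^esub> X \<in> Bd" if r: "r \<in> carrier R" and "X \<in> Bd" for r X
  proof -
    obtain a s where a: "a \<in> C" "low a s" "X = frac R g a s" using \<open>X \<in> Bd\<close> by (rule boundaries_cases)
    have "low (r * a) s"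
      unfolding low_def
    proof (intro allI impI)
      fix p q assume "p < d * s" "q < d * s"
      then have "coeff2 a (p - i) (q - j) = 0" for i j
        using a(2) by (simp add: low_def less_imp_diff_less)
      then show "coeff2 (r * a) p q = 0" by (simp add: coeff2_mult)
    qed
    then show ?thesis using r a by (simp add: smult_frac frac_in_boundaries_iff closed)
  qed
  show ?thesis
  proof (rule L.submoduleI)
    show "Bd \<subseteq> carrier Loc" by (rule boundaries_subset)
    show "\<zero>\<^bsub>Loc\<^esub> \<in> Bd"
      by (simp add: zero_Loc frac_in_boundaries_iff closed low_def)
    show "X \<oplus>\<^bsub>Loc\<^esub> Y \<in> Bd" if "X \<in> Bd" "Y \<in> Bd" for X Y
    proof -
      obtain a s where a: "a \<in> C" "low a s" "X = frac R g a s" using \<open>X \<in> Bd\<close> by (rule boundaries_cases)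
      obtain b t where b: "b \<in> C" "low b t" "Y = frac R g b t" using \<open>Y \<in> Bd\<close> by (rule boundaries_cases)
      show ?thesis
        unfolding a(3) b(3) add_frac[OF a(1) b(1)] using a b
        by (subst frac_in_boundaries_iff) (auto intro!: closed low_add)
    qed
    show "\<ominus>\<^bsub>Loc\<^esub> X \<in> Bd" if "X \<in> Bd" for X
    proof -
      have X: "X \<in> carrier Loc" using that boundaries_subset by blast
      have "\<ominus>\<^bsub>R\<^esub> \<one>\<^bsub>R\<^esub> \<odot>\<^bsub>Loc\<^esub> X = \<ominus>\<^bsub>Loc\<^esub> X"
        using X L.smult_l_minus[of "\<one>\<^bsub>R\<^esub>" X] L.R.one_closed by (simp only: L.smult_one)
      then show ?thesis using smult[OF L.R.a_inv_closed[OF L.R.one_closed] that] by simp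
    qed
  qed (rule smult)
qed

lemma module_H: "module R H"
  unfolding H_eq using module_Loc submodule_boundaries by (rule module.module_quotient_module)

lemma H_cases:
  assumes "U \<in> carrier H"
  obtains a s where "a \<in> C" "U = cls a s"
  using assms module.quotient_cosetE[OF module_Loc] Loc_cases unfolding H_eq by metis

lemma cls_in_H: "a \<in> C \<Longrightarrow> cls a s \<in> carrier H"
  unfolding H_eq by (intro module.coset_in_quotient[OF module_Loc] frac_in_Loc)

lemma add_cls:
  assumes "a \<in> C" "b \<in> C"
  shows "cls a s \<oplus>\<^bsub>H\<^esub> cls b t = cls (g ^ t * a + g ^ s * b) (s + t)"
proof -
  interpret abelian_subgroup Bd Loc
    by (rule module.submodule_imp_abelian_subgroup[OF module_Loc submodule_boundaries])
  show ?thesis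
    using assms unfolding H_eq by (simp add: a_rcos_sum frac_in_Loc add_frac)
qed

lemma smult_cls:
  assumes "r \<in> C" "a \<in> C"
  shows "r \<odot>\<^bsub>H\<^esub> cls a s = cls (r * a) s"
  using assms module.quotient_smult_coset[OF module_Loc submodule_boundaries, of r "frac R g a s"]
  unfolding H_eq by (simp add: frac_in_Loc smult_frac)

lemma zero_H: "\<zero>\<^bsub>H\<^esub> = Bd"
  unfolding H_eq by simp

lemma cls_eq_zero_iff:
  assumes "a \<in> C"
  shows "cls a s = \<zero>\<^bsub>H\<^esub> \<longleftrightarrow> low a s"
proof -
  interpret L: module R Loc by (rule module_Loc)
  interpret abelian_subgroup Bd Loc
    by (rule module.submodule_imp_abelian_subgroup[OF module_Loc submodule_boundaries])
  have "cls a s = Bd \<longleftrightarrow> frac R g a s \<in> Bd"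
    using a_rcos_self[OF frac_in_Loc[OF assms]] L.M.a_coset_join2[OF frac_in_Loc[OF assms] a_subgroup]
    by metis
  then show ?thesis unfolding zero_H frac_in_boundaries_iff[OF assms] .
qed

section \<open>The closure of zero in top local cohomology\<close>

text \<open>Removing the factor \<open>x y\<close> moves the diagonal position down by one in both
  directions. All coefficients of \<open>c\<close> that enter there have exponents below
  \<open>d * u\<close>, so they vanish. This makes the pairing below blind to boundaries.\<close>

lemma coeff2_xy_low:
  assumes "low c u"
  shows "coeff2 (ps_x * ps_y * n * c) (d * u) (d * u) = 0"
proof (cases "u = 0")
  \<comment> \<open>For \<open>u = 0\<close> the assumption on \<open>c\<close> is empty, but a
    multiple of \<open>x y\<close> has no constant term.\<close>
  case True
  then show ?thesis
    using coeff2_monom_mult[of 1 1 "n * c" 0 0] by (simp add: mult.assoc)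
next
  case False
  then have "coeff2 (ps_x * ps_y * n * c) (d * u) (d * u) = coeff2 (n * c) (d * u - 1) (d * u - 1)"
    using coeff2_monom_mult[of 1 1 "n * c" "d * u" "d * u"] d by (simp add: mult.assoc)
  also have "\<dots> = 0"
    unfolding coeff2_mult
  proof (intro sum.neutral ballI)
    fix i j
    have "d * u - 1 - i < d * u" for i using False d by simp
    then show "coeff2 n i j * coeff2 c (d * u - 1 - i) (d * u - 1 - j) = 0"
      using assms by (simp add: low_def)
  qed
  finally show ?thesis .
qed

text \<open>
  The coefficient of \<open>x\<^sup>0y\<^sup>0\<close> in \<open>m a / g\<^sup>s\<close>. It depends only on the class of \<open>a / g\<^sup>s\<close> if \<open>m\<close> is
  divisible by \<open>x y\<close>.
\<close>

definition pairing :: "'k fps fps \<Rightarrow> ('k fps fps \<times> nat) set set \<Rightarrow> 'k"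
  where "pairing m U =
    (SOME c. \<exists>a s. a \<in> C \<and> U = cls a s \<and> c = coeff2 (m * a) (d * s) (d * s))"

text \<open>Expanding \<open>a / g ^ s\<close> by \<open>g ^ t\<close> does not change the
  coefficient of \<open>x^0 y^0\<close>.\<close>

lemma coeff2_g_power_diagonal:
  "coeff2 (m * (g ^ t * a)) (d * (s + t)) (d * (s + t)) = coeff2 (m * a) (d * s) (d * s)"
  using coeff2_g_power_mult[of t "m * a" "d * (s + t)" "d * (s + t)"]
  by (simp add: distrib_left mult.left_commute del: power_mult_distrib)

text \<open>Two representatives of a class differ by a boundary, which contributes nothing by
  \<open>coeff2_xy_low\<close>; expanding fractions is harmless by
  \<open>coeff2_g_power_diagonal\<close>. Thus the choice in \<open>pairing\<close> is
  immaterial.\<close>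

lemma pairing_cls:
  assumes a: "a \<in> C"
  shows "pairing (ps_x * ps_y * n) (cls a s) = coeff2 (ps_x * ps_y * n * a) (d * s) (d * s)"
proof -
  interpret L: module R Loc by (rule module_Loc)
  interpret abelian_subgroup Bd Loc
    by (rule module.submodule_imp_abelian_subgroup[OF module_Loc submodule_boundaries])
  let ?m = "ps_x * ps_y * n"
  have unique: "coeff2 (?m * b) (d * t) (d * t) = coeff2 (?m * a) (d * s) (d * s)"
    if b: "b \<in> C" and eq: "cls a s = cls b t" for b t
  proof -
    have "frac R g b t \<in> cls a s"
      unfolding eq by (rule a_rcos_self[OF frac_in_Loc[OF b]])
    then obtain X where X: "X \<in> Bd" "frac R g b t = X \<oplus>\<^bsub>Loc\<^esub> frac R g a s"
      by (auto simp: a_r_coset_def')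
    obtain c u where c: "c \<in> C" "low c u" "X = frac R g c u" using X(1) by (rule boundaries_cases)
    have "frac R g b t = frac R g (g ^ s * c + g ^ u * a) (u + s)"
      unfolding X(2) c(3) by (rule add_frac[OF c(1) a])
    then have "g ^ (u + s) * b = g ^ t * (g ^ s * c + g ^ u * a)"
      using a b c by (subst (asm) frac_eq_iff) (auto intro!: closed)
    then have eq': "?m * (g ^ (u + s) * b) = ?m * (g ^ t * (g ^ s * c + g ^ u * a))" by simp
    have "coeff2 (?m * b) (d * t) (d * t) =
        coeff2 (?m * (g ^ (u + s) * b)) (d * (t + (u + s))) (d * (t + (u + s)))"
      by (rule coeff2_g_power_diagonal[symmetric])
    also have "\<dots> = coeff2 (?m * (g ^ t * (g ^ s * c + g ^ u * a))) (d * ((u + s) + t)) (d * ((u + s) + t))"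
      unfolding eq' by (simp only: add.commute)
    also have "\<dots> = coeff2 (?m * (g ^ s * c + g ^ u * a)) (d * (u + s)) (d * (u + s))"
      by (rule coeff2_g_power_diagonal)
    also have "\<dots> = coeff2 (?m * (g ^ s * c)) (d * (u + s)) (d * (u + s)) +
        coeff2 (?m * (g ^ u * a)) (d * (s + u)) (d * (s + u))"
      by (simp only: distrib_left coeff2_simps add.commute)
    also have "\<dots> = coeff2 (?m * a) (d * s) (d * s)"
      unfolding coeff2_g_power_diagonal coeff2_xy_low[OF c(2)] by simp
    finally show ?thesis .
  qed
  have "\<exists>b t. b \<in> C \<and> cls a s = cls b t \<and>
      pairing ?m (cls a s) = coeff2 (?m * b) (d * t) (d * t)"
    unfolding pairing_def
    by (rule someI[of _ "coeff2 (?m * a) (d * s) (d * s)"]) (use a in blast)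
  then show ?thesis using unique by metis
qed

section \<open>The modules \<open>M_i\<close> and triviality of the closure for
  \<open>i \<le> d - 2\<close>\<close>

lemma monomial_module_simps [simp]:
  "\<zero>\<^bsub>monomial_module d' i\<^esub> = 0" "f \<oplus>\<^bsub>monomial_module d' i\<^esub> h = f + h"
  "r \<odot>\<^bsub>monomial_module d' i\<^esub> f = r * f"
  by (simp_all add: monomial_module_def)

lemma monomial_moduleI:
  assumes "\<And>j. j \<le> i \<Longrightarrow> r j \<in> C"
  shows "(\<Sum>j\<le>i. ps_x ^ (i - j) * ps_y ^ j * r j) \<in> carrier (monomial_module d i)"
  using assms by (auto simp: monomial_module_def)

lemma monomial_moduleE:
  assumes "b \<in> carrier (monomial_module d i)"
  obtains r where "\<forall>j\<le>i. r j \<in> C" "b = (\<Sum>j\<le>i. ps_x ^ (i - j) * ps_y ^ j * r j)"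
  using assms by (auto simp: monomial_module_def)

lemma monomial_in_monomial_module:
  assumes r: "r \<in> C" and j: "j \<le> i"
  shows "ps_x ^ (i - j) * ps_y ^ j * r \<in> carrier (monomial_module d i)"
proof -
  have "ps_x ^ (i - j) * ps_y ^ j * r =
      (\<Sum>l\<le>i. ps_x ^ (i - l) * ps_y ^ l * (if l = j then r else 0))"
    using j by (simp add: if_distrib[of "\<lambda>x. _ * x"] sum.delta cong: if_cong)
  also have "\<dots> \<in> carrier (monomial_module d i)"
    using r by (intro monomial_moduleI) (auto intro: closed)
  finally show ?thesis .
qed

lemma module_monomial_module: "module R (monomial_module d i)"
proof -
  let ?M = "monomial_module d i :: ('k fps fps, 'k fps fps) module"
  have add: "b + c \<in> carrier ?M" if "b \<in> carrier ?M" "c \<in> carrier ?M" for b c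
  proof -
    obtain r where r: "\<forall>j\<le>i. r j \<in> C" "b = (\<Sum>j\<le>i. ps_x ^ (i - j) * ps_y ^ j * r j)"
      using \<open>b \<in> carrier ?M\<close> by (rule monomial_moduleE)
    obtain s where s: "\<forall>j\<le>i. s j \<in> C" "c = (\<Sum>j\<le>i. ps_x ^ (i - j) * ps_y ^ j * s j)"
      using \<open>c \<in> carrier ?M\<close> by (rule monomial_moduleE)
    have "b + c = (\<Sum>j\<le>i. ps_x ^ (i - j) * ps_y ^ j * (r j + s j))"
      unfolding r(2) s(2) by (simp add: distrib_left sum.distrib)
    also have "\<dots> \<in> carrier ?M" using r(1) s(1) by (intro monomial_moduleI closed) simp_all
    finally show ?thesis .
  qed
  have smult: "a * b \<in> carrier ?M" if a: "a \<in> C" and "b \<in> carrier ?M" for a b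
  proof -
    obtain r where r: "\<forall>j\<le>i. r j \<in> C" "b = (\<Sum>j\<le>i. ps_x ^ (i - j) * ps_y ^ j * r j)"
      using \<open>b \<in> carrier ?M\<close> by (rule monomial_moduleE)
    have "a * b = (\<Sum>j\<le>i. ps_x ^ (i - j) * ps_y ^ j * (a * r j))"
      unfolding r(2) by (simp add: sum_distrib_left mult.left_commute)
    also have "\<dots> \<in> carrier ?M" using a r(1) by (intro monomial_moduleI closed) simp_all
    finally show ?thesis .
  qed
  have "abelian_group ?M"
  proof (rule abelian_groupI)
    show "\<zero>\<^bsub>?M\<^esub> \<in> carrier ?M"
      using monomial_in_monomial_module[OF closed(1), of 0 i] by simp
    fix b assume "b \<in> carrier ?M"
    then have "- b \<in> carrier ?M" using smult[OF closed(6)[OF closed(2)]] by simp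
    then show "\<exists>c\<in>carrier ?M. c \<oplus>\<^bsub>?M\<^esub> b = \<zero>\<^bsub>?M\<^esub>" by (rule bexI[rotated]) simp
  qed (simp_all add: add algebra_simps)
  then show ?thesis
    using cring_veronese[OF d] by (intro moduleI) (simp_all add: smult algebra_simps)
qed

lemma module_closure_zero_trivial:
  assumes i: "i + 2 \<le> d" and U: "U \<in> module_closure R (monomial_module d i) H {\<zero>\<^bsub>H\<^esub>}"
  shows "U = \<zero>\<^bsub>H\<^esub>"
proof (rule ccontr)
  interpret H: module R H by (rule module_H)
  assume nonzero: "U \<noteq> \<zero>\<^bsub>H\<^esub>"
  have "U \<in> carrier H" using U by (simp add: module_closure_def)
  then obtain f s where f: "f \<in> C" "U = cls f s" by (rule H_cases)
  then have "\<not> low f s" using nonzero cls_eq_zero_iff by metis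
  then obtain p q where pq: "p < d * s" "q < d * s" "coeff2 f p q \<noteq> 0" by (auto simp: low_def)
  \<comment> \<open>The chosen term of \<open>f / g ^ s\<close> is a multiple of
    \<open>x^(-p') y^(-q')\<close>, with both \<open>p'\<close> and \<open>q'\<close>
    positive.\<close>
  define p' q' where "p' = d * s - p" and "q' = d * s - q"
  have "d dvd p + q" using f(1) pq(3) veronese_carrier_iff[OF d] by blast
  then have "d dvd (d * s + d * s) - (p + q)" by (intro dvd_diff_nat) simp_all
  also have "(d * s + d * s) - (p + q) = p' + q'" using pq by (simp add: p'_def q'_def)
  finally have "d \<le> p' + q'" using pq by (intro dvd_imp_le) (simp_all add: p'_def)
  moreover have "p' > 0" "q' > 0" using pq by (simp_all add: p'_def q'_def)
  \<comment> \<open>The generator \<open>x^(i-j) y^j\<close> must divide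
    \<open>x^(p'-1) y^(q'-1)\<close>. Taking \<open>j\<close> as large as \<open>i\<close> and
    \<open>q' - 1\<close> permit leaves \<open>i - j < p'\<close>, because
    \<open>i + 2 \<le> d \<le> p' + q'\<close>.\<close>
  moreover define j where "j = min i (q' - 1)"
  ultimately have j: "j \<le> i" "j < q'" "i - j < p'" using i by (auto simp: j_def min_def)
  define b :: "'k fps fps" where "b = ps_x ^ (i - j) * ps_y ^ j"
  \<comment> \<open>The complementary monomial, chosen so that \<open>x y n b\<close> is
    \<open>x^p' y^q'\<close>; pairing with it extracts the coefficient of \<open>f\<close> at
    \<open>p, q\<close>.\<close>
  define n :: "'k fps fps" where "n = ps_x ^ (p' - 1 - (i - j)) * ps_y ^ (q' - 1 - j)"
  have b: "b \<in> carrier (monomial_module d i)"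
    using monomial_in_monomial_module[OF closed(2) j(1)] by (simp add: b_def)
  let ?\<phi> = "\<lambda>c. pairing (ps_x * ps_y * (n * c))"
  have "?\<phi> b U = 0"
  proof (rule module_closure_pairing_zero[of R "monomial_module d i" H "{\<zero>\<^bsub>H\<^esub>}" ?\<phi>])
    show "module R (monomial_module d i)" by (rule module_monomial_module)
    show "module R H" by (rule module_H)
    show "submodule {\<zero>\<^bsub>H\<^esub>} R H" by (rule H.submoduleI) auto
    fix c V assume "V \<in> carrier H"
    then obtain a t where a: "a \<in> C" "V = cls a t" by (rule H_cases)
    show "?\<phi> (c \<oplus>\<^bsub>monomial_module d i\<^esub> c') V = ?\<phi> c V + ?\<phi> c' V" for c'
      unfolding a(2) pairing_cls[OF a(1)] monomial_module_simps
      by (simp only: distrib_left distrib_right coeff2_simps)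
    show "?\<phi> (r \<odot>\<^bsub>monomial_module d i\<^esub> c) V = ?\<phi> c (r \<odot>\<^bsub>H\<^esub> V)" if "r \<in> carrier R" for r
    proof -
      have r: "r \<in> C" using that by simp
      show ?thesis
        unfolding a(2) smult_cls[OF r a(1)] pairing_cls[OF a(1)] pairing_cls[OF closed(4)[OF r a(1)]]
          monomial_module_simps by (simp only: mult_ac)
    qed
    fix W assume "W \<in> carrier H"
    then obtain h t' where h: "h \<in> C" "W = cls h t'" by (rule H_cases)
    let ?m = "ps_x * ps_y * (n * c)"
    have "?\<phi> c (V \<oplus>\<^bsub>H\<^esub> W) =
        coeff2 (?m * (g ^ t' * a + g ^ t * h)) (d * (t + t')) (d * (t + t'))"
      unfolding a(2) h(2) add_cls[OF a(1) h(1)] using a(1) h(1)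
      by (intro pairing_cls closed)
    also have "\<dots> = coeff2 (?m * (g ^ t' * a)) (d * (t + t')) (d * (t + t')) +
        coeff2 (?m * (g ^ t * h)) (d * (t' + t)) (d * (t' + t))"
      by (simp only: distrib_left coeff2_simps add.commute)
    also have "\<dots> = ?\<phi> c V + ?\<phi> c W"
      unfolding coeff2_g_power_diagonal a(2) h(2) pairing_cls[OF a(1)] pairing_cls[OF h(1)] ..
    finally show "?\<phi> c (V \<oplus>\<^bsub>H\<^esub> W) = ?\<phi> c V + ?\<phi> c W" .
  next
    fix c V assume "V \<in> {\<zero>\<^bsub>H\<^esub>}"
    moreover have "cls 0 0 = \<zero>\<^bsub>H\<^esub>" by (simp add: cls_eq_zero_iff closed low_def)
    ultimately show "?\<phi> c V = 0" using pairing_cls[OF closed(1), of "n * c" 0] by simp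
  qed (fact U b)+
  moreover have "ps_x * ps_y * (n * b) = ps_x ^ p' * ps_y ^ q'"
  proof -
    have "p' = Suc ((p' - 1 - (i - j)) + (i - j))" "q' = Suc ((q' - 1 - j) + j)" using j by simp_all
    then have "ps_x ^ p' * ps_y ^ q' = ps_x ^ Suc ((p' - 1 - (i - j)) + (i - j)) *
        (ps_y ^ Suc ((q' - 1 - j) + j) :: 'k fps fps)" by metis
    then show ?thesis unfolding n_def b_def by (simp add: power_add mult_ac)
  qed
  moreover have "coeff2 (ps_x ^ p' * ps_y ^ q' * f) (d * s) (d * s) = coeff2 f p q"
    using pq by (simp add: coeff2_monom_mult p'_def q'_def)
  ultimately show False
    using pq(3) pairing_cls[OF f(1), of "n * b" s] unfolding f(2) by metis
qed

section \<open>The socle class and the closure for \<open>i = d - 1\<close>\<close>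

definition socle_class :: "('k fps fps \<times> nat) set set"
  where "socle_class = cls (ps_x ^ (d - 1) * ps_y) 1"

lemma socle_monom_closed: "ps_x ^ (d - 1) * ps_y \<in> C"
  using monom_in_veronese[OF d, of "d - 1" 1] d by simp

lemma socle_class_in_H: "socle_class \<in> carrier H"
  unfolding socle_class_def by (rule cls_in_H[OF socle_monom_closed])

text \<open>The constant term of \<open>r\<close> reappears as the coefficient of
  \<open>x^(d-1) y\<close> in \<open>r x^(d-1) y\<close>. For \<open>d \<ge> 2\<close> both
  exponents are below \<open>d\<close>, so it must vanish if the product represents zero; for
  \<open>d = 1\<close> the class itself would be zero.\<close>

lemma annihilates_socle_class:
  assumes d2: "d \<ge> 2" and r: "r \<in> C" and zero: "r \<odot>\<^bsub>H\<^esub> socle_class = \<zero>\<^bsub>H\<^esub>"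
  shows "coeff2 r 0 0 = 0"
proof -
  have "low (r * (ps_x ^ (d - 1) * ps_y)) 1"
    using zero unfolding socle_class_def smult_cls[OF r socle_monom_closed]
      cls_eq_zero_iff[OF closed(4)[OF r socle_monom_closed]] .
  then have "coeff2 (r * (ps_x ^ (d - 1) * ps_y)) (d - 1) 1 = 0" using d2 by (simp add: low_def)
  then show ?thesis
    using coeff2_monom_mult[of "d - 1" 1 r "d - 1" 1] by (simp add: mult.commute)
qed

text \<open>
  With \<open>v = 1 / (x\<^sup>d y\<^sup>d)\<close> the socle class is \<open>x\<^sup>d\<^sup>-\<^sup>1 y v\<close>. For a generator \<open>m\<close> of \<open>M\<^bsub>d-1\<^esub>\<close>, the
  product \<open>x\<^sup>d\<^sup>-\<^sup>1 y m\<close> is \<open>x\<^sup>d\<close> or \<open>y\<^sup>d\<close> times another generator, and \<open>x\<^sup>d\<close> and \<open>y\<^sup>d\<close> kill \<open>v\<close>.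
\<close>

lemma socle_class_in_closure:
  assumes d2: "d \<ge> 2"
  shows "socle_class \<in> module_closure R (monomial_module d (d - 1)) H {\<zero>\<^bsub>H\<^esub>}"
proof (rule pure_tensor_eq_zero_imp_module_closure)
  interpret H: module R H by (rule module_H)
  let ?M = "monomial_module d (d - 1) :: ('k fps fps, 'k fps fps) module"
  let ?T = "tensor_relations R ?M H"
  show M: "module R ?M" by (rule module_monomial_module)
  show "module R H" by (rule module_H)
  show "submodule {\<zero>\<^bsub>H\<^esub>} R H" by (rule H.submoduleI) auto
  show "socle_class \<in> carrier H" by (rule socle_class_in_H)
  fix b assume b: "b \<in> carrier ?M"
  obtain k where k: "d = Suc (Suc k)" using d2 by (metis add_2_eq_Suc le_Suc_ex)
  then have k': "d - 1 = Suc k" by simp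
  note rel = pure_tensor_relations[OF M module_H]
  have v: "cls 1 1 \<in> carrier H" by (rule cls_in_H[OF closed(2)])
  \<comment> \<open>The scalar \<open>f\<close> crosses the tensor sign and annihilates
    \<open>cls 1 1\<close>.\<close>
  have kill: "frag_of (f * c, cls 1 1) \<in> ?T"
    if c: "c \<in> carrier ?M" and f: "f \<in> C" "low (f * 1) 1" for f c
  proof -
    have "f \<odot>\<^bsub>H\<^esub> cls 1 1 = \<zero>\<^bsub>H\<^esub>"
      using f by (simp add: smult_cls closed cls_eq_zero_iff)
    then show ?thesis using rel(3)[of f c "cls 1 1"] rel(2)[OF c] f c v by simp
  qed
  \<comment> \<open>The factor \<open>1\<close> gives the terms the shape that the coefficient rules
    expect.\<close>
  have low: "low (ps_x ^ d * 1) 1" "low (ps_y ^ d * 1) 1"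
    unfolding low_def coeff2_ps_x_mult coeff2_ps_y_mult by simp_all
  obtain r where r: "\<forall>j\<le>d - 1. r j \<in> C"
    and b_eq: "b = (\<Sum>j\<le>d - 1. ps_x ^ (d - 1 - j) * ps_y ^ j * r j)"
    using b by (rule monomial_moduleE)
  \<comment> \<open>Multiplication by \<open>x^(d-1) y\<close> turns the generator with index
    \<open>j < d - 1\<close> into \<open>x^d\<close> times the one with index \<open>j + 1\<close>,
    so the coefficients shift by one. The last generator \<open>y^(d-1)\<close> becomes
    \<open>y^d\<close> times the one with index \<open>0\<close>, which accounts for
    \<open>b2\<close>.\<close>
  define r' where "r' j = (if j = 0 then 0 else r (j - 1))" for j
  define b1 where "b1 = (\<Sum>j\<le>d - 1. ps_x ^ (d - 1 - j) * ps_y ^ j * r' j)"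
  define b2 where "b2 = ps_x ^ (d - 1) * r (d - 1)"
  have b1: "b1 \<in> carrier ?M"
    unfolding b1_def using r by (intro monomial_moduleI) (auto simp: r'_def closed)
  have b2: "b2 \<in> carrier ?M"
    unfolding b2_def using monomial_in_monomial_module[of "r (d - 1)" 0 "d - 1"] r by simp
  have "ps_x ^ (d - 1) * ps_y * b = ps_x ^ d * b1 + ps_y ^ d * b2"
  proof -
    have b_eq': "b = (\<Sum>j\<le>k. ps_x ^ (Suc k - j) * ps_y ^ j * r j) + ps_y ^ Suc k * r (Suc k)"
      unfolding b_eq k' by simp
    have b1_eq: "b1 = (\<Sum>j\<le>k. ps_x ^ (k - j) * ps_y ^ Suc j * r j)"
      unfolding b1_def k' sum.atMost_Suc_shift by (simp add: r'_def)
    have "ps_x ^ Suc k * ps_y * (\<Sum>j\<le>k. ps_x ^ (Suc k - j) * ps_y ^ j * r j) = ps_x ^ d * b1"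
      unfolding b1_eq sum_distrib_left k
      by (intro sum.cong refl) (simp add: Suc_diff_le mult_ac)
    moreover have "ps_x ^ Suc k * ps_y * (ps_y ^ Suc k * r (Suc k)) = ps_y ^ d * b2"
      unfolding b2_def k' by (simp add: k mult_ac)
    ultimately show ?thesis unfolding b_eq' k' by (simp only: distrib_left)
  qed
  then have "frag_of (ps_x ^ (d - 1) * ps_y * b, cls 1 1) \<in> ?T"
    using rel(1)[of "ps_x ^ d * b1" "ps_y ^ d * b2" "cls 1 1"] v
      kill[OF b1 params_closed(1) low(1)] kill[OF b2 params_closed(2) low(2)]
      module.smult_closed[OF M, of _ b1] module.smult_closed[OF M, of _ b2] b1 b2 params_closed
    by simp
  \<comment> \<open>The scalar \<open>x^(d-1) y\<close> now moves back across the tensor sign, from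
    \<open>b\<close> to \<open>cls 1 1\<close>.\<close>
  moreover have "socle_class = (ps_x ^ (d - 1) * ps_y) \<odot>\<^bsub>H\<^esub> cls 1 1"
    unfolding socle_class_def smult_cls[OF socle_monom_closed closed(2)] by (simp only: mult_1_right)
  ultimately show "frag_of (b, socle_class) \<in> ?T"
    using rel(3)[of "ps_x ^ (d - 1) * ps_y" b "cls 1 1"] b v socle_monom_closed by simp
qed

section \<open>The residue field, its injective hull, and rationality\<close>

lemma residue_field_submodule: "submodule (carrier R - Units R) R (regular_module R)"
proof -
  interpret cring R by (rule cring_veronese[OF d])
  interpret M: module R "regular_module R" by (rule module_regular_module[OF cring_veronese[OF d]])
  have eq: "carrier R - Units R = {f \<in> C. coeff2 f 0 0 = 0}"
    unfolding veronese_Units[OF d] by auto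
  have sel: "carrier (regular_module R) = C" "\<zero>\<^bsub>regular_module R\<^esub> = 0"
    "f \<oplus>\<^bsub>regular_module R\<^esub> h = f + h" "f \<odot>\<^bsub>regular_module R\<^esub> h = f * h" for f h
    by (simp_all add: regular_module_def)
  show ?thesis
    unfolding eq
  proof (rule M.submoduleI)
    fix f assume f: "f \<in> {f \<in> C. coeff2 f 0 0 = 0}"
    have "\<ominus>\<^bsub>regular_module R\<^esub> f = - f"
      by (rule M.M.minus_equality) (use f in \<open>simp_all add: sel closed\<close>)
    then show "\<ominus>\<^bsub>regular_module R\<^esub> f \<in> {f \<in> C. coeff2 f 0 0 = 0}"
      using f by (simp add: closed)
  qed (auto simp: sel closed coeff2_mult)
qed

text \<open>The closure of zero contains nothing but zero, so every linear map to \<open>E\<close>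
  kills it.\<close>

lemma cl_rational_monomial_module:
  assumes E: "residue_injective_hull R E" and i: "i + 2 \<le> d"
  shows "cl_rational R params E (module_closure R (monomial_module d i))"
proof -
  have "module R E"
    using E by (simp add: residue_injective_hull_def injective_hull_def injective_module_def)
  then show ?thesis
    unfolding cl_rational_def closure_trace_def canonical_module_def Let_def
    using module_closure_zero_trivial[OF i] linear_maps_zero[OF module_H] by blast
qed

text \<open>The element \<open>e\<close> is the image of the residue class of \<open>1\<close> under
  the embedding of the residue field: it is nonzero by injectivity and killed by the maximal ideal
  by linearity.\<close>

lemma residue_injective_hull_socle:
  assumes E: "residue_injective_hull R E"
  obtains e where "e \<in> carrier E" "e \<noteq> \<zero>\<^bsub>E\<^esub>"
    and "\<And>r. r \<in> C \<Longrightarrow> coeff2 r 0 0 = 0 \<Longrightarrow> r \<odot>\<^bsub>E\<^esub> e = \<zero>\<^bsub>E\<^esub>"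
proof -
  let ?S = "regular_module R" and ?m = "carrier R - Units R"
  let ?K = "residue_field R"
  have moduleS: "module R ?S" by (rule module_regular_module[OF cring_veronese[OF d]])
  interpret S: module R ?S by (rule moduleS)
  interpret m: abelian_subgroup ?m ?S
    by (rule S.submodule_imp_abelian_subgroup[OF residue_field_submodule])
  have moduleE: "module R E"
    using E by (simp add: residue_injective_hull_def injective_hull_def injective_module_def)
  have moduleK: "module R ?K"
    unfolding residue_field_def by (rule S.module_quotient_module[OF residue_field_submodule])
  obtain \<iota> where \<iota>: "\<iota> \<in> linear_maps R ?K E" and inj: "inj_on \<iota> (carrier ?K)"
    using E by (auto simp: residue_injective_hull_def injective_hull_def)
  have one: "1 \<in> carrier ?S" by (simp add: regular_module_def closed)
  have zeroK: "\<zero>\<^bsub>?K\<^esub> = ?m" by (simp add: residue_field_def)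
  define u where "u = ?m +>\<^bsub>?S\<^esub> 1"
  have u: "u \<in> carrier ?K"
    unfolding u_def residue_field_def by (rule S.coset_in_quotient[OF one])
  have "1 \<in> u" unfolding u_def by (rule m.a_rcos_self[OF one])
  moreover have "1 \<notin> ?m" by (simp add: veronese_Units[OF d] closed)
  ultimately have "u \<noteq> \<zero>\<^bsub>?K\<^esub>" unfolding zeroK by blast
  show thesis
  proof (rule that[of "\<iota> u"])
    show "\<iota> u \<in> carrier E" using \<iota> u by (auto simp: linear_maps_def)
    have "\<zero>\<^bsub>?K\<^esub> \<in> carrier ?K"
      using moduleK by (simp add: module_def abelian_group_def abelian_monoid.zero_closed)
    then show "\<iota> u \<noteq> \<zero>\<^bsub>E\<^esub>"
      using linear_maps_zero[OF moduleK moduleE \<iota>] \<open>u \<noteq> \<zero>\<^bsub>?K\<^esub>\<close> inj_onD[OF inj _ u] by metis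
    fix r assume r: "r \<in> C" "coeff2 r 0 0 = 0"
    have rS: "r \<in> carrier ?S" "r \<in> carrier R" using r by (simp_all add: regular_module_def)
    have "r \<odot>\<^bsub>?K\<^esub> u = ?m +>\<^bsub>?S\<^esub> (r \<odot>\<^bsub>?S\<^esub> 1)"
      unfolding u_def residue_field_def
      by (rule S.quotient_smult_coset[OF residue_field_submodule rS(2) one])
    also have "r \<odot>\<^bsub>?S\<^esub> 1 = r" by (simp add: regular_module_def)
    also have "?m +>\<^bsub>?S\<^esub> r = \<zero>\<^bsub>?K\<^esub>"
      unfolding zeroK using r by (intro S.M.a_coset_join2[OF rS(1) m.a_subgroup])
        (simp add: veronese_Units[OF d])
    finally have "\<iota> (r \<odot>\<^bsub>?K\<^esub> u) = \<zero>\<^bsub>E\<^esub>"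
      using linear_maps_zero[OF moduleK moduleE \<iota>] by simp
    moreover have "\<iota> (r \<odot>\<^bsub>?K\<^esub> u) = r \<odot>\<^bsub>E\<^esub> \<iota> u"
      using \<iota> u rS(2) unfolding linear_maps_def by blast
    ultimately show "r \<odot>\<^bsub>E\<^esub> \<iota> u = \<zero>\<^bsub>E\<^esub>" by simp
  qed
qed

lemma not_cl_rational_monomial_module:
  assumes E: "residue_injective_hull R E" and d2: "d \<ge> 2"
  shows "\<not> cl_rational R params E (module_closure R (monomial_module d (d - 1)))"
proof
  assume rational: "cl_rational R params E (module_closure R (monomial_module d (d - 1)))"
  have inj: "injective_module TYPE(('k fps fps \<times> nat) set set) R E"
    using E by (simp add: residue_injective_hull_def injective_hull_def)
  then have moduleE: "module R E" by (simp add: injective_module_def)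
  obtain e where e: "e \<in> carrier E" "e \<noteq> \<zero>\<^bsub>E\<^esub>"
    and ann: "\<And>r. r \<in> C \<Longrightarrow> coeff2 r 0 0 = 0 \<Longrightarrow> r \<odot>\<^bsub>E\<^esub> e = \<zero>\<^bsub>E\<^esub>"
    using residue_injective_hull_socle[OF E] by metis
  let ?N = "{r \<odot>\<^bsub>H\<^esub> socle_class |r. r \<in> carrier R}"
  obtain f where f: "f \<in> linear_maps R (H\<lparr>carrier := ?N\<rparr>) E" and fe: "f socle_class = e"
  proof (rule cyclic_submodule_map[OF module_H moduleE socle_class_in_H e(1)])
    fix r assume r: "r \<in> carrier R" "r \<odot>\<^bsub>H\<^esub> socle_class = \<zero>\<^bsub>H\<^esub>"
    then have "r \<in> C" by simp
    then show "r \<odot>\<^bsub>E\<^esub> e = \<zero>\<^bsub>E\<^esub>" using annihilates_socle_class[OF d2 _ r(2)] ann by blast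
  qed
  have N: "submodule ?N R H" by (rule cyclic_submodule[OF module_H socle_class_in_H])
  \<comment> \<open>The elements of \<open>H\<close> have the type on which injectivity of
    \<open>E\<close> is tested, so \<open>f\<close> extends from the cyclic submodule to all of
    \<open>H\<close>.\<close>
  obtain h where h: "h \<in> linear_maps R H E" and hf: "\<forall>u\<in>?N. h u = f u"
    using inj[unfolded injective_module_def] module_H N f by blast
  have "\<one>\<^bsub>R\<^esub> \<odot>\<^bsub>H\<^esub> socle_class = socle_class"
    by (rule module.smult_one[OF module_H socle_class_in_H])
  then have "socle_class \<in> ?N" using closed(2) by force
  then have "h socle_class = e" using hf fe by simp
  \<comment> \<open>Rationality forces every linear map, in particular \<open>h\<close>, to vanish
    on the closure of zero.\<close>
  moreover have "h socle_class = \<zero>\<^bsub>E\<^esub>"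
    using rational h socle_class_in_closure[OF d2]
    unfolding cl_rational_def closure_trace_def canonical_module_def Let_def by blast
  ultimately show False using e(2) by simp
qed

end

theorem proposition5p1:
  fixes d :: nat
    and E :: "('k::field fps fps, 'e) module"
  assumes "d \<ge> 1"
    and "residue_injective_hull (veronese d :: 'k fps fps ring) E"
  shows "(\<forall>i. i + 2 \<le> d \<longrightarrow>
            cl_rational (veronese d) [ps_x ^ d, ps_y ^ d] E
              (module_closure (veronese d) (monomial_module d i))) \<and>
         (d \<ge> 2 \<longrightarrow>
            \<not> cl_rational (veronese d) [ps_x ^ d, ps_y ^ d] E
              (module_closure (veronese d) (monomial_module d (d - 1))))"
proof -
  have d: "d > 0" using assms(1) by simp
  \<comment> \<open>The monomial \<open>x^d y^d\<close> has degree \<open>2d\<close>, so it lies in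
    the Veronese ring, and it is nonzero.\<close>
  have "veronese_cohomology TYPE('k) d"
    by unfold_locales (use d monom_in_veronese[OF d, of d d] ps_power_nonzero in auto)
  then show ?thesis
    using veronese_cohomology.cl_rational_monomial_module[OF _ assms(2)]
      veronese_cohomology.not_cl_rational_monomial_module[OF _ assms(2)]
    by blast
qed

end
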